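(* Let $q$ be a power of $2$ and let $r$ be a positive integer. Then there exists a $q^{2r}\times q^{2r}$ real orthogonal matrix $D$ of multiplicative order $q^{2r-1}+1$ whose $q^{2r-1}+1$ powers $D, D^2, \dots, D^{q^{2r-1}+1}=I$ define $q^{2r-1}+1$ mutually unbiased bases in $\mathbb{R}^{q^{2r}}$. Thus the scaled matrices $q^rD, q^rD^2, \dots, q^rD^{q^{2r-1}}$ are $q^{2r-1}$ different real Hadamard matrices.
   Context: Here "power of $2$" means $q=2^a$ with $a\ge 1$. Two orthonormal bases $\{u_1,\dots,u_d\}$ and $\{v_1,\dots,v_d\}$ of $\mathbb{R}^d$ are mutually unbiased if $\langle u_i,v_j\rangle^2=1/d$ for all $1\le i,j\le d$. A $d\times d$ real orthogonal matrix is identified with an orthonormal basis of $\mathbb{R}^d$. The bases corresponding to orthogonal matrices $O_1,O_2$ are mutually unbiased if and only if every entry of $O_1O_2^{-1}$ equals $\pm 1/\sqrt{d}$. A family of orthogonal matrices defines mutually unbiased bases if the corresponding bases are pairwise mutually unbiased. (For a group of orthogonal matrices it makes no difference whether rows or columns are used for the identification.) A real Hadamard matrix of size $d$ is a $d\times d$ matrix $H$ with entries $\pm1$ and $HH^T=dI$. *)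

theory Defs
  imports Complex_Main "Jordan_Normal_Form.VS_Connect"
begin

text \<open>The library's \<open>orthogonal_mat\<close> only asks for pairwise orthogonal nonzero columns, not for
  columns of norm 1.\<close>

definition real_orthogonal_mat :: "nat \<Rightarrow> real mat \<Rightarrow> bool" where
  "real_orthogonal_mat d A \<longleftrightarrow>
     A \<in> carrier_mat d d \<and> A * A\<^sup>T = 1\<^sub>m d \<and> A\<^sup>T * A = 1\<^sub>m d"

definition has_mat_order :: "nat \<Rightarrow> real mat \<Rightarrow> nat \<Rightarrow> bool" where
  "has_mat_order d A m \<longleftrightarrow>
     0 < m \<and> A ^\<^sub>m m = 1\<^sub>m d \<and> (\<forall>k. 0 < k \<and> k < m \<longrightarrow> A ^\<^sub>m k \<noteq> 1\<^sub>m d)"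

definition orthonormal_basis :: "nat \<Rightarrow> real vec set \<Rightarrow> bool" where
  "orthonormal_basis d B \<longleftrightarrow>
     vectorspace.basis class_ring (module_vec TYPE(real) d) B \<and>
     (\<forall>u\<in>B. \<forall>v\<in>B. u \<bullet> v = (if u = v then 1 else 0))"

definition mutually_unbiased :: "nat \<Rightarrow> real vec set \<Rightarrow> real vec set \<Rightarrow> bool" where
  "mutually_unbiased d B C \<longleftrightarrow>
     orthonormal_basis d B \<and> orthonormal_basis d C \<and>
     (\<forall>u\<in>B. \<forall>v\<in>C. (u \<bullet> v)\<^sup>2 = 1 / real d)"

text \<open>An orthogonal matrix is identified with the basis formed by its rows, so that the scalar
  products between the bases of \<open>A\<close> and \<open>B\<close> are the entries of \<open>A * B\<^sup>T\<close>, where \<open>B\<^sup>T\<close> is the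
  inverse of \<open>B\<close>.\<close>

definition basis_of_mat :: "real mat \<Rightarrow> real vec set" where
  "basis_of_mat A = set (rows A)"

text \<open>Distinct indices must give mutually unbiased, hence for \<open>d > 1\<close> distinct, bases: the family
  indexed by a finite set \<open>I\<close> then consists of exactly \<open>card I\<close> bases.\<close>

definition defines_mubs :: "nat \<Rightarrow> 'i set \<Rightarrow> ('i \<Rightarrow> real mat) \<Rightarrow> bool" where
  "defines_mubs d I A \<longleftrightarrow>
     (\<forall>i\<in>I. real_orthogonal_mat d (A i)) \<and>
     (\<forall>i\<in>I. \<forall>j\<in>I. i \<noteq> j \<longrightarrow>
        mutually_unbiased d (basis_of_mat (A i)) (basis_of_mat (A j)))"

definition real_hadamard_mat :: "nat \<Rightarrow> real mat \<Rightarrow> bool" where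
  "real_hadamard_mat d H \<longleftrightarrow>
     H \<in> carrier_mat d d \<and>
     (\<forall>i<d. \<forall>j<d. H $$ (i, j) = 1 \<or> H $$ (i, j) = -1) \<and>
     H * H\<^sup>T = real d \<cdot>\<^sub>m 1\<^sub>m d"

end

theory Submission
  imports Defs "HOL-Library.Z2" "HOL-Algebra.Multiplicative_Group" "HOL-Algebra.Algebraic_Closure_Type"
begin

text \<open>
  Let \<open>M \<subseteq> L\<close> be the fields with \<open>Q = q ^ (2 * r - 1)\<close> and \<open>Q\<^sup>2\<close> elements, with norm \<open>Nm\<close> and
  trace \<open>Tr\<close> from \<open>L\<close> to \<open>M\<close>, let \<open>lam\<close> be the absolute trace of \<open>M\<close>, and fix \<open>om\<close> in \<open>L\<close> of trace 1.
  The twisted group algebra of \<open>L\<close> has a basis \<open>E u\<close> with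
  \<open>E u * E v = (-1) ^ lam (Tr (om * u * cj v)) E (u + v)\<close>. In it put
  \<open>D s = - (1 / Q) (\<Sum>u\<in>L. (-1) ^ lam (s * Nm u) E u)\<close> for \<open>s\<close> in \<open>M\<close>. Completing the square and using
  \<open>(\<Sum>u\<in>L. (-1) ^ lam (c * Nm u)) = - Q\<close> one finds that the \<open>D s\<close>, together with 1, multiply like the
  norm-one elements \<open>x\<close> of \<open>L\<close> under \<open>s = 1 / (1 + x) + om\<close>; these form a cyclic group of order
  \<open>Q + 1\<close>. In the regular representation all entries of \<open>D s\<close> are \<open>\<plusminus> 1 / Q\<close>. To reach dimension
  \<open>q ^ (2 * r)\<close> one induces instead from a sign character of the commuting elements \<open>E t\<close>, \<open>t\<close> in \<open>T\<close>,
  where \<open>T\<close> is the kernel of the trace from \<open>M\<close> to the field with \<open>q\<close> elements. The entries then are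
  Gauss sums over \<open>T\<close>, and they still have constant modulus because the form \<open>lam (t * t')\<close> is
  nondegenerate on \<open>T\<close>.
\<close>

section \<open>The algebraic closure of the field with two elements\<close>

hide_const (open) Polynomials.degree up_ring.monom up_ring.coeff

text \<open>Every finite field of characteristic 2 embeds in this field, so all fields below are
  subsets of one type, and counting roots only requires separability.\<close>

type_synonym K = "bit alg_closure"

lemma CHAR_bit [simp]: "CHAR(bit) = 2"
proof -
  have "CHAR(bit) dvd 2"
    using of_nat_eq_0_iff_char_dvd[of 2, where ?'a = bit] by simp
  moreover have "CHAR(bit) \<noteq> 1"
    using of_nat_eq_0_iff_char_dvd[of 1, where ?'a = bit] by auto
  ultimately show ?thesis
    using prime_nat_iff two_is_prime_nat by metis
qed

lemma K_two: "(1::K) + 1 = 0"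
  by (metis CHAR_bit CHAR_alg_closure of_nat_CHAR of_nat_1 of_nat_add one_add_one)

lemma K_double [simp]: "(x::K) + x = 0"
  using K_two by (metis distrib_right mult_zero_left mult_1)

lemma K_double_left [simp]: "(x::K) + (x + y) = y"
  by (simp flip: add.assoc)

lemma K_uminus [simp]: "- (x::K) = x"
  by (simp add: neg_eq_iff_add_eq_0)

lemma K_minus [simp]: "(x::K) - y = x + y"
  using K_uminus by (metis diff_conv_add_uminus)

lemma K_add_eq_0_iff: "(x::K) + y = 0 \<longleftrightarrow> x = y"
  by (metis K_uminus neg_eq_iff_add_eq_0)

lemma K_add_pow2: "((x::K) + y) ^ (2 ^ m) = x ^ (2 ^ m) + y ^ (2 ^ m)"
  by (rule freshmans_dream'[where n = m]) simp_all

lemma K_sum_pow2: "(\<Sum>i\<in>A. f i :: K) ^ (2 ^ m) = (\<Sum>i\<in>A. f i ^ (2 ^ m))"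
  by (rule freshmans_dream_sum'[where n = m]) simp_all

lemma K_sum_square: "(\<Sum>i\<in>A. f i :: K)\<^sup>2 = (\<Sum>i\<in>A. (f i)\<^sup>2)"
  using K_sum_pow2[of f A 1] by simp

text \<open>Over an algebraically closed field \<open>x ^ n - c\<close> splits into \<open>n\<close>
  linear factors. They are distinct because the derivative \<open>n * x ^ (n - 1)\<close> vanishes
  at most at 0, which is no root since \<open>c\<close> is nonzero.\<close>

lemma card_nth_roots_K:
  assumes n: "odd n" and c: "c \<noteq> 0"
  shows "card {x::K. x ^ n = c} = n"
proof -
  define p where "p = monom 1 n - [:c:]"
  have n0: "n > 0" using n by (auto intro: Nat.gr0I)
  have deg: "degree p = n"
    unfolding p_def using n0 by (subst diff_conv_add_uminus, subst degree_add_eq_left) (auto simp: degree_monom_eq)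
  have poly_p: "poly p x = x ^ n - c" for x
    by (simp add: p_def poly_monom)
  have "coeff p n = 1" using n0 by (auto simp: p_def coeff_pCons split: nat.splits)
  then have lc: "coeff p (degree p) = 1" by (simp add: deg)
  have p0: "p \<noteq> 0" using lc by auto
  obtain A where A: "size A = n" "p = (\<Prod>x\<in>#A. [:-x, 1:])"
    using alg_closed_imp_factorization[OF p0] lc deg by (metis smult_1_left)
  have roots: "x \<in># A \<longleftrightarrow> x ^ n = c" for x
  proof -
    have "poly p x = (\<Prod>y\<in>#A. x - y)"
      by (simp add: A(2) poly_prod_mset image_mset.compositionality o_def add.commute)
    then have "poly p x = 0 \<longleftrightarrow> x \<in># A"
      by (auto simp: prod_mset_zero_iff K_add_eq_0_iff)
    then show ?thesis by (simp add: poly_p K_add_eq_0_iff)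
  qed
  have simple: "count A x = 1" if x: "x \<in># A" for x
  proof (rule ccontr)
    assume "count A x \<noteq> 1"
    moreover have "count A x > 0" using x by simp
    ultimately have "count (A - {#x#}) x \<noteq> 0" unfolding count_diff count_single if_True refl[THEN eqTrueI] by linarith
    then have "x \<in># A - {#x#}" by (metis count_eq_zero_iff)
    then obtain B where "A = {#x, x#} + B"
      using x by (metis insert_DiffM add_mset_add_single union_mset_add_mset_left add.left_neutral)
    then have "p = [:-x, 1:] * ([:-x, 1:] * (\<Prod>y\<in>#B. [:-y, 1:]))"
      by (simp add: A(2))
    then have "poly (pderiv p) x = 0"
      by (simp only: pderiv_mult poly_mult poly_add) simp
    moreover have "pderiv p = monom (of_nat n) (n - 1)"
      by (simp add: p_def pderiv_diff pderiv_monom pderiv_pCons)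
    ultimately have "of_nat n * x ^ (n - 1) = 0"
      by (simp add: poly_monom)
    moreover have "of_nat n \<noteq> (0::K)" using n by (simp add: of_nat_eq_0_iff_char_dvd)
    ultimately have "x = 0" by auto
    then show False using roots[of x] x n0 c by auto
  qed
  have "n = (\<Sum>x\<in>set_mset A. count A x)"
    using A(1) by (simp add: size_multiset_overloaded_eq)
  also have "\<dots> = card (set_mset A)" using simple by simp
  also have "set_mset A = {x. x ^ n = c}" using roots by auto
  finally show ?thesis by simp
qed

text \<open>The nonzero fixed points are the roots of unity for the odd exponent
  \<open>2 ^ m - 1\<close>; 0 is the remaining one.\<close>

lemma card_frobenius_fixed:
  assumes "m > 0"
  shows "card {x::K. x ^ (2 ^ m) = x} = 2 ^ m" and "finite {x::K. x ^ (2 ^ m) = x}"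
proof -
  have od: "odd (2 ^ m - 1 :: nat)" using assms by simp
  have fin: "finite {x::K. x ^ (2 ^ m - 1) = 1}"
    using card_nth_roots_K[OF od, of 1] od by (intro card_ge_0_finite) (simp only: odd_pos one_neq_zero not_False_eq_True)
  have split: "x ^ (2 ^ m) = x * x ^ (2 ^ m - 1)" for x :: K
    by (metis power_eq_if pos2 zero_less_power neq0_conv)
  have eq: "{x::K. x ^ (2 ^ m) = x} = insert 0 {x. x ^ (2 ^ m - 1) = 1}"
    by (auto simp: split zero_power od odd_pos)
  have "(0::K) \<notin> {x. x ^ (2 ^ m - 1) = 1}"
    using zero_power[OF odd_pos[OF od], where ?'a = K]
    by (simp only: mem_Collect_eq zero_neq_one not_False_eq_True)
  then show "card {x::K. x ^ (2 ^ m) = x} = 2 ^ m"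
    unfolding eq card_insert_disjoint[OF fin \<open>0 \<notin> _\<close>] by (simp only: card_nth_roots_K[OF od one_neq_zero] Suc_diff_1 zero_less_power pos2)
  show "finite {x::K. x ^ (2 ^ m) = x}" using fin by (simp add: eq)
qed

section \<open>Character sums and cyclic groups of units\<close>

text \<open>Translation by \<open>s\<close> permutes the finite set \<open>A\<close>, so the sum
  equals \<open>f s\<close> times itself.\<close>

lemma sum_character_eq_0:
  fixes f :: "'a::cancel_comm_monoid_add \<Rightarrow> real"
  assumes fin: "finite A" and s: "s \<in> A" "f s \<noteq> 1"
    and closed: "\<And>x y. x \<in> A \<Longrightarrow> y \<in> A \<Longrightarrow> x + y \<in> A"
    and f: "\<And>x y. x \<in> A \<Longrightarrow> y \<in> A \<Longrightarrow> f (x + y) = f x * f y"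
  shows "(\<Sum>x\<in>A. f x) = 0"
proof -
  have inj: "inj_on ((+) s) A" by (auto simp: inj_on_def)
  then have im: "(+) s ` A = A"
    using fin closed s by (intro card_subset_eq) (auto simp: card_image)
  have "(\<Sum>x\<in>A. f x) = (\<Sum>x\<in>A. f (s + x))"
    using inj by (subst im[symmetric], subst sum.reindex) auto
  also have "\<dots> = f s * (\<Sum>x\<in>A. f x)" using f s by (simp add: sum_distrib_left)
  finally show ?thesis using s by simp
qed

text \<open>Carries the cyclicity of the unit group of a finite field over from rings with explicit
  carriers. The order of \<open>g\<close> is stated as a lower bound on exponents, the form in which
  it is used later.\<close>

lemma finite_subfield_generator:
  fixes L :: "'a::Fields.field set"
  assumes fin: "finite L" and one: "1 \<in> L"
    and diff: "\<And>x y. x \<in> L \<Longrightarrow> y \<in> L \<Longrightarrow> x - y \<in> L"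
    and mult: "\<And>x y. x \<in> L \<Longrightarrow> y \<in> L \<Longrightarrow> x * y \<in> L"
    and inv: "\<And>x. x \<in> L \<Longrightarrow> inverse x \<in> L"
  obtains g where "g \<in> L" "g \<noteq> 0" "\<And>e. 0 < e \<Longrightarrow> g ^ e = 1 \<Longrightarrow> card L - 1 \<le> e"
proof -
  define R :: "'a ring" where "R = \<lparr>carrier = L, monoid.mult = (*), one = 1, zero = 0, add = (+)\<rparr>"
  have zero: "0 \<in> L" using diff[OF one one] by simp
  have neg: "- x \<in> L" if "x \<in> L" for x using diff[OF zero that] by simp
  have add: "x + y \<in> L" if "x \<in> L" "y \<in> L" for x y
    using diff[OF that(1) neg[OF that(2)]] by simp
  have 1: "\<exists>y\<in>L. y + x = 0 \<and> x + y = 0" if "x \<in> L" for x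
    using neg[OF that] by (intro bexI[of _ "- x"]) auto
  have 2: "\<exists>y\<in>L. y * x = 1 \<and> x * y = 1" if "x \<in> L" "x \<noteq> 0" for x
    using inv[OF that(1)] that(2) by (intro bexI[of _ "inverse x"]) auto
  interpret R: field R
    by unfold_locales
      (use one zero add mult 1 2 in \<open>auto simp: R_def Units_def algebra_simps\<close>)
  have pow: "x [^]\<^bsub>R\<^esub> (n::nat) = x ^ n" for x n
    by (induction n) (auto simp: R_def nat_pow_def mult.commute)
  obtain g where g: "g \<in> carrier (mult_of R)"
    "carrier (mult_of R) = {g [^]\<^bsub>R\<^esub> i | i::nat. i \<in> UNIV}"
    using R.finite_field_mult_group_has_gen fin by (auto simp: R_def)
  have C: "carrier (mult_of R) = L - {0}" by (simp add: carrier_mult_of R_def)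
  have im: "L - {0} = range ((^) g)" using g(2) unfolding C pow by auto
  show ?thesis
  proof (rule that[of g])
    show "g \<in> L" "g \<noteq> 0" using g(1) unfolding C by auto
    fix e :: nat assume e: "0 < e" "g ^ e = 1"
    \<comment> \<open>Exponents reduce modulo \<open>e\<close>, so \<open>g\<close> has at most
      \<open>e\<close> distinct powers, yet they fill all of \<open>L - {0}\<close>.\<close>
    have "L - {0} \<subseteq> (^) g ` {..<e}"
    proof
      fix x assume "x \<in> L - {0}"
      then obtain i where x: "x = g ^ i" using im by auto
      have "g ^ i = g ^ (i mod e + e * (i div e))" by simp
      also have "\<dots> = g ^ (i mod e)" unfolding power_add power_mult by (simp add: e)
      finally show "x \<in> (^) g ` {..<e}" using e x by auto
    qed
    then have "card (L - {0}) \<le> card {..<e}"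
      by (meson surj_card_le finite_lessThan)
    then show "card L - 1 \<le> e" using fin zero by simp
  qed
qed

section \<open>A quadratic extension of finite fields\<close>

locale quadratic_extension =
  fixes k :: nat
  assumes k_pos: "k > 0"
begin

text \<open>\<open>cj\<close> restricts to the nontrivial automorphism of \<open>L\<close> over
  \<open>M\<close>. The values of \<open>lam\<close> lie in \<open>K\<close>; they are 0 or 1 on
  \<open>M\<close>, and there \<open>chi\<close> is an additive character.\<close>

definition cj :: "K \<Rightarrow> K" where "cj x = x ^ (2 ^ k)"
definition M :: "K set" where "M = {x. cj x = x}"
definition L :: "K set" where "L = {x. cj (cj x) = x}"
definition Tr :: "K \<Rightarrow> K" where "Tr x = x + cj x"
definition Nm :: "K \<Rightarrow> K" where "Nm x = x * cj x"
definition lam :: "K \<Rightarrow> K" where "lam x = (\<Sum>i<k. x ^ (2 ^ i))"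
definition chi :: "K \<Rightarrow> real" where "chi x = (if lam x = 0 then 1 else -1)"

lemma cj_add [simp]: "cj (x + y) = cj x + cj y" by (simp add: cj_def K_add_pow2)
lemma cj_mult [simp]: "cj (x * y) = cj x * cj y" by (simp add: cj_def power_mult_distrib)
lemma cj_0 [simp]: "cj 0 = 0" and cj_1 [simp]: "cj 1 = 1" by (simp_all add: cj_def)
lemma cj_power [simp]: "cj (x ^ n) = cj x ^ n" by (simp add: cj_def flip: power_mult) (simp add: mult.commute)
lemma cj_divide [simp]: "cj (x / y) = cj x / cj y" by (simp add: cj_def power_divide)
lemma cj_inverse [simp]: "cj (inverse x) = inverse (cj x)" by (simp add: cj_def power_inverse)
lemma cj_eq_0_iff [simp]: "cj x = 0 \<longleftrightarrow> x = 0" by (simp add: cj_def)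
lemma cj_M: "x \<in> M \<Longrightarrow> cj x = x" by (simp add: M_def)
lemma cj_cj: "x \<in> L \<Longrightarrow> cj (cj x) = x" by (simp add: L_def)

lemma M_subset_L: "M \<subseteq> L" by (auto simp: M_def L_def)
lemma M_in_L: "x \<in> M \<Longrightarrow> x \<in> L" using M_subset_L by auto

lemma M_closed [simp, intro]:
  "0 \<in> M" "1 \<in> M" "x \<in> M \<Longrightarrow> y \<in> M \<Longrightarrow> x + y \<in> M" "x \<in> M \<Longrightarrow> y \<in> M \<Longrightarrow> x * y \<in> M"
  "x \<in> M \<Longrightarrow> y \<in> M \<Longrightarrow> x / y \<in> M" "x \<in> M \<Longrightarrow> x ^ n \<in> M"
  by (auto simp: M_def)

lemma L_closed [simp, intro]:
  "0 \<in> L" "1 \<in> L" "x \<in> L \<Longrightarrow> y \<in> L \<Longrightarrow> x + y \<in> L" "x \<in> L \<Longrightarrow> y \<in> L \<Longrightarrow> x * y \<in> L"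
  "x \<in> L \<Longrightarrow> y \<in> L \<Longrightarrow> x / y \<in> L" "x \<in> L \<Longrightarrow> inverse x \<in> L" "x \<in> L \<Longrightarrow> cj x \<in> L"
  by (auto simp: L_def)

lemma Tr_in_M [simp, intro]: "x \<in> L \<Longrightarrow> Tr x \<in> M"
  by (auto simp: Tr_def M_def L_def add.commute)

lemma Nm_in_M [simp, intro]: "x \<in> L \<Longrightarrow> Nm x \<in> M"
  by (auto simp: Nm_def M_def L_def mult.commute)

lemma Tr_add: "Tr (x + y) = Tr x + Tr y" by (simp add: Tr_def ac_simps)

lemma M_eq: "M = {x. x ^ (2 ^ k) = x}" by (simp add: M_def cj_def)
lemma L_eq: "L = {x. x ^ (2 ^ (2 * k)) = x}"
  by (simp add: L_def cj_def mult_2 power_add flip: power_mult)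

lemma finite_M [simp]: "finite M" and card_M: "card M = 2 ^ k"
  using card_frobenius_fixed[OF k_pos] by (simp_all add: M_eq)

lemma finite_L [simp]: "finite L" and card_L: "card L = (2 ^ k) ^ 2"
  using card_frobenius_fixed[of "2 * k"] k_pos by (simp_all add: L_eq power_mult mult.commute)

lemma lam_add: "lam (x + y) = lam x + lam y"
  by (simp add: lam_def K_add_pow2 sum.distrib)

lemma lam_square: "(lam x)\<^sup>2 = lam (x\<^sup>2)"
  using K_sum_pow2[of "\<lambda>i. x ^ (2 ^ i)" "{..<k}" 1]
  by (simp add: lam_def mult.commute flip: power_mult)

text \<open>Squaring shifts the summands by one place, and on \<open>M\<close> the last one returns
  to \<open>x\<close>.\<close>

lemma lam_square_M:
  assumes "x \<in> M" shows "lam (x\<^sup>2) = lam x"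
proof -
  have "x + lam (x\<^sup>2) = (\<Sum>i<Suc k. x ^ (2 ^ i))"
    by (subst sum.lessThan_Suc_shift) (simp add: lam_def flip: power_mult)
  also have "\<dots> = lam x + x" using assms by (simp add: lam_def M_eq)
  finally show ?thesis by (metis add.commute add_left_imp_eq)
qed

lemma lam_cases: "x \<in> M \<Longrightarrow> lam x = 0 \<or> lam x = 1"
  using lam_square[of x] lam_square_M[of x] by (auto simp: power2_eq_square)

lemma chi_0 [simp]: "chi 0 = 1" by (simp add: chi_def lam_def)
lemma chi_square [simp]: "chi x * chi x = 1" by (simp add: chi_def)

lemma chi_add: "x \<in> M \<Longrightarrow> y \<in> M \<Longrightarrow> chi (x + y) = chi x * chi y"
  using lam_cases[of x] lam_cases[of y] by (auto simp: chi_def lam_add)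

text \<open>\<open>lam\<close> is a polynomial function of degree at most \<open>2 ^ (k - 1)\<close>
  with linear coefficient 1: nonzero, but with too few roots to vanish on \<open>M\<close>.\<close>

lemma lam_nontrivial: obtains m where "m \<in> M" "lam m \<noteq> 0"
proof -
  define p where "p = (\<Sum>i<k. monom (1::K) (2 ^ i))"
  have poly_p: "poly p x = lam x" for x by (simp add: p_def poly_sum poly_monom lam_def)
  have deg: "degree p \<le> 2 ^ (k - 1)"
    unfolding p_def by (intro degree_sum_le) (auto intro!: order_trans[OF degree_monom_le] power_increasing)
  have "coeff p 1 = (\<Sum>i<k. if i = 0 then 1 else 0)"
    unfolding p_def coeff_sum by (intro sum.cong) (auto simp: coeff_monom)
  then have "coeff p 1 = 1" using k_pos by simp
  then have p0: "p \<noteq> 0" by auto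
  have "(2::nat) ^ (k - 1) < 2 ^ k" using k_pos by (intro power_strict_increasing) auto
  then have "card {x. poly p x = 0} < 2 ^ k"
    using card_poly_roots_bound[OF p0] deg by linarith
  then have "\<not> M \<subseteq> {x. poly p x = 0}"
    using card_mono[OF poly_roots_finite[OF p0], of M] card_M by auto
  then show ?thesis using that by (auto simp: poly_p)
qed

lemma sum_chi_M:
  assumes "c \<in> M" "c \<noteq> 0" shows "(\<Sum>m\<in>M. chi (c * m)) = 0"
proof -
  obtain m where m: "m \<in> M" "lam m \<noteq> 0" by (rule lam_nontrivial)
  show ?thesis
    by (rule sum_character_eq_0[of _ "m / c"])
      (use assms m in \<open>auto simp: distrib_left chi_add\<close>, auto simp: chi_def)
qed

text \<open>The norm is the power with odd exponent \<open>2 ^ k + 1\<close>, so its fibre in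
  \<open>K\<close> can be counted. The whole fibre lies in \<open>L\<close>: applying
  \<open>cj\<close> to \<open>Nm u = m\<close> and cancelling \<open>cj u\<close> gives
  \<open>cj (cj u) = u\<close>.\<close>

lemma card_norm_fibre:
  assumes m: "m \<in> M" "m \<noteq> 0"
  shows "card {u \<in> L. Nm u = m} = 2 ^ k + 1"
proof -
  have Nm: "Nm u = u ^ (2 ^ k + 1)" for u by (simp add: Nm_def cj_def)
  have "u \<in> L" if "Nm u = m" for u
  proof -
    have "cj (Nm u) = Nm u" using that m by (simp add: cj_M)
    then have "cj u * cj (cj u) = cj u * u" by (simp add: Nm_def mult.commute)
    moreover have "cj u \<noteq> 0" using that m by (auto simp: Nm_def)
    ultimately show ?thesis by (simp add: L_def)
  qed
  then have "{u \<in> L. Nm u = m} = {u. u ^ (2 ^ k + 1) = m}" by (auto simp: Nm)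
  then show ?thesis using card_nth_roots_K[of "2 ^ k + 1" m] m k_pos by simp
qed

text \<open>Grouping by norm, 0 contributes 1, and each nonzero \<open>m\<close> contributes
  \<open>2 ^ k + 1\<close> times \<open>chi (c * m)\<close>. These character values sum to -1 over
  \<open>M - {0}\<close>.\<close>

lemma sum_chi_Nm:
  assumes c: "c \<in> M" "c \<noteq> 0"
  shows "(\<Sum>u\<in>L. chi (c * Nm u)) = - (2 ^ k)"
proof -
  have "(\<Sum>u\<in>L. chi (c * Nm u)) = (\<Sum>m\<in>M. \<Sum>u | u \<in> L \<and> Nm u = m. chi (c * Nm u))"
    by (rule sum.group[symmetric]) auto
  also have "\<dots> = (\<Sum>m\<in>M. real (card {u \<in> L. Nm u = m}) * chi (c * m))"
    by (intro sum.cong) auto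
  also have "\<dots> = real (card {u \<in> L. Nm u = 0}) * chi (c * 0) +
      (\<Sum>m\<in>M - {0}. real (card {u \<in> L. Nm u = m}) * chi (c * m))"
    by (rule sum.remove) auto
  also have "{u \<in> L. Nm u = 0} = {0}" by (auto simp: Nm_def)
  also have "(\<Sum>m\<in>M - {0}. real (card {u \<in> L. Nm u = m}) * chi (c * m)) =
      (2 ^ k + 1) * (\<Sum>m\<in>M - {0}. chi (c * m))"
    unfolding sum_distrib_left by (intro sum.cong) (auto simp: card_norm_fibre)
  also have "(\<Sum>m\<in>M - {0}. chi (c * m)) = -1"
    using sum_chi_M[OF c] sum.remove[of M 0 "\<lambda>m. chi (c * m)"] by simp
  finally show ?thesis by simp
qed

text \<open>The second elementary symmetric function of the conjugates of \<open>x\<close>. On elements of trace 0 it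
  is a quadratic form over the field with two elements whose polar form is \<open>lam (x * y)\<close>.\<close>

definition e2 :: "K \<Rightarrow> K" where
  "e2 x = (\<Sum>j<k. x ^ (2 ^ j) * (\<Sum>i<j. x ^ (2 ^ i)))"

lemma e2_add: "e2 (x + y) = e2 x + e2 y + lam x * lam y + lam (x * y)"
proof -
  let ?s = "\<lambda>x j. \<Sum>i<j. (x::K) ^ (2 ^ i)"
  \<comment> \<open>The product of the two partial sums splits into off-diagonal terms, on the left,
    and diagonal terms, which form the partial sum for \<open>x * y\<close>.\<close>
  have "(\<Sum>j<m. x ^ (2 ^ j) * ?s y j + y ^ (2 ^ j) * ?s x j) = ?s x m * ?s y m + ?s (x * y) m" for m
    by (induction m) (simp_all add: power_mult_distrib algebra_simps)
  from this[of k] have "(\<Sum>j<k. x ^ (2 ^ j) * ?s y j + y ^ (2 ^ j) * ?s x j) = lam x * lam y + lam (x * y)"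
    by (simp add: lam_def)
  moreover have "e2 (x + y) = e2 x + e2 y + (\<Sum>j<k. x ^ (2 ^ j) * ?s y j + y ^ (2 ^ j) * ?s x j)"
    by (simp add: e2_def K_add_pow2 sum.distrib algebra_simps)
  ultimately show ?thesis by (simp add: add.assoc)
qed

text \<open>Squaring permutes the conjugates of \<open>x\<close> cyclically and hence fixes their
  symmetric function \<open>e2 x\<close>; only 0 and 1 are fixed by squaring.\<close>

lemma e2_cases:
  assumes "x \<in> M" shows "e2 x = 0 \<or> e2 x = 1"
proof -
  let ?s = "\<lambda>j. \<Sum>i<j. x ^ (2 ^ i)"
  \<comment> \<open>Chosen so that squaring the \<open>j\<close>-th summand of \<open>e2 x\<close>
    gives exactly \<open>h (Suc j)\<close>.\<close>
  define h where "h j = x ^ (2 ^ j) * (?s j + x)" for j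
  have s2: "(?s j)\<^sup>2 = ?s (Suc j) + x" for j
    unfolding K_sum_square
    by (subst sum.lessThan_Suc_shift) (simp add: mult.commute add.commute flip: power_mult)
  have "(e2 x)\<^sup>2 = (\<Sum>j<k. (x ^ (2 ^ j))\<^sup>2 * (?s j)\<^sup>2)"
    unfolding e2_def K_sum_square[of "\<lambda>j. x ^ (2 ^ j) * ?s j"] by (simp only: power_mult_distrib)
  also have "\<dots> = (\<Sum>j<k. h (Suc j))"
    unfolding s2 h_def by (intro sum.cong refl) (simp add: mult.commute flip: power_mult)
  \<comment> \<open>The doubled term \<open>h 0\<close> is zero; one copy completes the shifted sum
    so that it can be reindexed.\<close>
  also have "\<dots> = h 0 + (h 0 + (\<Sum>j<k. h (Suc j)))" by simp
  also have "\<dots> = h 0 + (h k + (\<Sum>j<k. h j))"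
    using sum.lessThan_Suc_shift[of h k] by (simp add: add.commute)
  also have "(\<Sum>j<k. h j) = e2 x + x * lam x"
    by (simp add: h_def e2_def lam_def distrib_left sum.distrib sum_distrib_left mult.commute)
  also have "h k = x * lam x + x * x" using assms by (simp add: h_def M_eq lam_def distrib_left)
  also have "h 0 = x * x" by (simp add: h_def)
  finally have "e2 x * e2 x = e2 x" by (simp add: power2_eq_square ac_simps)
  then show ?thesis by auto
qed

text \<open>\<open>T\<close> is the kernel of the trace \<open>tr\<close> from \<open>M\<close> to
  its subfield \<open>F\<close> with \<open>2 ^ a\<close> elements, and \<open>phi\<close> is the
  sign given by \<open>e2\<close>. As \<open>n\<close> is odd, \<open>tr\<close> is the identity on
  \<open>F\<close>, so \<open>M\<close> is the direct sum of \<open>T\<close> and \<open>F\<close>,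
  orthogonal under \<open>lam (x * y)\<close>; thus nondegeneracy passes from \<open>M\<close> to
  \<open>T\<close>.\<close>

lemma exists_quadratic_subspace:
  assumes k: "k = a * n" and a: "a > 0" and n: "odd n"
  obtains T phi where "T \<subseteq> M" "0 \<in> T" "\<And>t t'. t \<in> T \<Longrightarrow> t' \<in> T \<Longrightarrow> t + t' \<in> T"
    "\<And>t. t \<in> T \<Longrightarrow> chi t = 1" "\<And>t. phi t * phi t = (1::real)"
    "\<And>t t'. t \<in> T \<Longrightarrow> t' \<in> T \<Longrightarrow> phi (t + t') = phi t * phi t' * chi (t * t')"
    "\<And>t. t \<in> T \<Longrightarrow> t \<noteq> 0 \<Longrightarrow> \<exists>t'\<in>T. chi (t * t') \<noteq> 1"
    "card T = 2 ^ (a * (n - 1))"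
proof -
  define F where "F = {x::K. x ^ (2 ^ a) = x}"
  define tr where "tr x = (\<Sum>i<n. (x::K) ^ (2 ^ (a * i)))" for x
  define T where "T = {t \<in> M. tr t = 0}"
  define phi where "phi t = (if e2 t = 0 then 1 else - 1 :: real)" for t
  have M_iff: "x \<in> M \<longleftrightarrow> x ^ (2 ^ (a * n)) = x" for x
    unfolding k[symmetric] by (simp add: M_eq)
  have lam_eq: "lam x = (\<Sum>l<n * a. x ^ (2 ^ l))" for x
    unfolding mult.commute[of n] k[symmetric] by (rule lam_def)
  have F: "finite F" "card F = 2 ^ a" using card_frobenius_fixed[OF a] by (simp_all add: F_def)
  have F_pow: "c ^ (2 ^ (a * i)) = c" if "c \<in> F" for c i
  proof (induction i)
    case (Suc i)
    have "c ^ (2 ^ (a * Suc i)) = (c ^ (2 ^ (a * i))) ^ (2 ^ a)"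
      by (simp add: power_add mult.commute flip: power_mult)
    then show ?case using Suc that by (simp add: F_def)
  qed simp
  have F_M: "c \<in> M" if "c \<in> F" for c using F_pow[OF that, of n] by (simp add: M_iff)
  have tr_add: "tr (x + y) = tr x + tr y" for x y by (simp add: tr_def K_add_pow2 sum.distrib)
  have tr_mult: "tr (c * x) = c * tr x" if "c \<in> F" for c x
    by (simp add: tr_def power_mult_distrib F_pow[OF that] sum_distrib_left)
  have tr_1: "tr 1 = 1"
  proof -
    have "(2::K) = 0" by (metis K_two one_add_one)
    then show ?thesis using n by (auto simp: tr_def elim!: oddE)
  qed
  have tr_F: "tr c = c" if "c \<in> F" for c using tr_mult[OF that, of 1] tr_1 by simp
  have tr_in_F: "tr x \<in> F" if "x \<in> M" for x
  proof -
    have "x + (tr x) ^ (2 ^ a) = (\<Sum>i<Suc n. x ^ (2 ^ (a * i)))"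
      unfolding tr_def K_sum_pow2
      by (subst sum.lessThan_Suc_shift) (simp add: power_add mult.commute flip: power_mult)
    also have "\<dots> = x + tr x" using that by (simp add: M_iff tr_def add.commute)
    finally show ?thesis by (simp add: F_def)
  qed
  \<comment> \<open>Transitivity of the trace: an exponent index below \<open>n * a\<close> is
    written as \<open>a * i + j\<close> with \<open>j < a\<close>.\<close>
  have lam_tr: "lam x = (\<Sum>j<a. (tr x) ^ (2 ^ j))" for x
  proof -
    have "lam x = (\<Sum>i<n. \<Sum>l\<in>{i * a..<i * a + a}. x ^ (2 ^ l))"
      unfolding lam_eq by (rule sum.nat_group[symmetric])
    also have "\<dots> = (\<Sum>i<n. \<Sum>j<a. x ^ (2 ^ (a * i + j)))"
    proof (rule sum.cong[OF refl])
      fix i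
      show "(\<Sum>l\<in>{i * a..<i * a + a}. x ^ (2 ^ l)) = (\<Sum>j<a. x ^ (2 ^ (a * i + j)))"
        by (rule sum.reindex_bij_witness[of _ "\<lambda>j. i * a + j" "\<lambda>l. l - i * a"])
          (auto simp: mult.commute)
    qed
    also have "\<dots> = (\<Sum>j<a. (tr x) ^ (2 ^ j))"
      unfolding tr_def K_sum_pow2 by (subst sum.swap) (simp add: power_add flip: power_mult)
    finally show ?thesis .
  qed
  have lam_T: "lam x = 0" if "tr x = 0" for x using that by (simp add: lam_tr)
  \<comment> \<open>\<open>m + tr m\<close> is the projection of \<open>m\<close> to
    \<open>T\<close> along \<open>F\<close>.\<close>
  have TI: "m + tr m \<in> T" if "m \<in> M" for m
    using that by (simp add: T_def tr_add tr_F tr_in_F F_M)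
  show ?thesis
  proof (rule that)
    show "T \<subseteq> M" by (auto simp: T_def)
    show "0 \<in> T" by (simp add: T_def tr_def)
    show "t + t' \<in> T" if "t \<in> T" "t' \<in> T" for t t' using that by (simp add: T_def tr_add)
    show "chi t = 1" if "t \<in> T" for t using that by (simp add: T_def chi_def lam_T)
    show "phi t * phi t = 1" for t by (simp add: phi_def)
    show "phi (t + t') = phi t * phi t' * chi (t * t')" if "t \<in> T" "t' \<in> T" for t t'
      using that e2_cases[of t] e2_cases[of t'] lam_cases[of "t * t'"]
      by (auto simp: T_def phi_def chi_def e2_add lam_T)
    show "\<exists>t'\<in>T. chi (t * t') \<noteq> 1" if t: "t \<in> T" "t \<noteq> 0" for t
    proof -
      obtain m0 where m0: "m0 \<in> M" "lam m0 \<noteq> 0" by (rule lam_nontrivial)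
      \<comment> \<open>This \<open>m\<close> pairs nontrivially with \<open>t\<close>, and so does
        its projection to \<open>T\<close>, because \<open>t\<close> is orthogonal to
        \<open>tr m\<close>.\<close>
      define m where "m = m0 / t"
      have m: "m \<in> M" "lam (t * m) \<noteq> 0" using m0 t by (auto simp: m_def T_def)
      have "lam (tr m * t) = 0" using t by (intro lam_T) (simp add: tr_mult tr_in_F m T_def)
      then have "lam (t * (m + tr m)) \<noteq> 0" using m by (simp add: distrib_left lam_add mult.commute)
      then show ?thesis using TI[OF m(1)] by (intro bexI[of _ "m + tr m"]) (simp_all add: chi_def)
    qed
    have "bij_betw (\<lambda>m. (m + tr m, tr m)) M (T \<times> F)"
      by (rule bij_betw_byWitness[of _ "\<lambda>(t, c). t + c"])
        (auto simp: TI tr_in_F tr_add tr_F T_def F_M add.assoc)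
    then have "2 ^ k = card T * 2 ^ a"
      using bij_betw_same_card card_M F by (metis card_cartesian_product)
    moreover have "(2::nat) ^ k = 2 ^ (a * (n - 1)) * 2 ^ a"
      using n by (auto simp: k power_add[symmetric] elim!: oddE)
    ultimately show "card T = 2 ^ (a * (n - 1))" by simp
  qed
qed

text \<open>A generator of the units of \<open>L\<close> has order
  \<open>(2 ^ k - 1) * (2 ^ k + 1)\<close>; its power with exponent \<open>2 ^ k - 1\<close> has the
  required order.\<close>

lemma norm_one_generator:
  obtains g :: K where "g ^ (2 ^ k + 1) = 1" "\<And>e. 0 < e \<Longrightarrow> g ^ e = 1 \<Longrightarrow> 2 ^ k + 1 \<le> e"
proof -
  obtain h where h: "h \<in> L" "h \<noteq> 0" "\<And>e. 0 < e \<Longrightarrow> h ^ e = 1 \<Longrightarrow> card L - 1 \<le> e"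
    by (rule finite_subfield_generator[of L]) auto
  have pos: "0 < (2::nat) ^ k - 1" using one_less_power[of "2::nat" k] k_pos by simp
  have card: "card L - 1 = (2 ^ k - 1) * (2 ^ k + 1)"
    by (simp add: card_L power2_eq_square algebra_simps)
  have "h * h ^ (card L - 1) = h ^ (2 ^ (2 * k))"
    by (simp add: card_L power_mult mult.commute flip: power_Suc)
  also have "\<dots> = h" using h(1) by (simp add: L_eq)
  finally have 1: "h ^ (card L - 1) = 1" using h(2) by simp
  show ?thesis
  proof (rule that[of "h ^ (2 ^ k - 1)"])
    show "(h ^ (2 ^ k - 1)) ^ (2 ^ k + 1) = 1" using 1 unfolding card by (simp only: power_mult)
    fix e :: nat assume "0 < e" "(h ^ (2 ^ k - 1)) ^ e = 1"
    then have "card L - 1 \<le> (2 ^ k - 1) * e" using pos by (intro h(3)) (simp_all only: power_mult nat_0_less_mult_iff)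
    then show "2 ^ k + 1 \<le> e" using pos unfolding card by (meson mult_le_cancel1)
  qed
qed

end

text \<open>In characteristic 2 the condition \<open>u + v \<in> T\<close> says that
  \<open>u\<close> and \<open>v\<close> lie in the same coset. As a predicate of \<open>v\<close> it
  depends only on the coset of \<open>u\<close>, so the chosen \<open>r u\<close> is constant on
  cosets.\<close>

lemma exists_transversal:
  fixes L T :: "K set"
  assumes T: "0 \<in> T" "\<And>t t'. t \<in> T \<Longrightarrow> t' \<in> T \<Longrightarrow> t + t' \<in> T" "T \<subseteq> L"
    and L: "\<And>t t'. t \<in> L \<Longrightarrow> t' \<in> L \<Longrightarrow> t + t' \<in> L"
  obtains S where "bij_betw (\<lambda>(x, t). x + t) (S \<times> T) L"
proof -
  define r where "r u = (SOME v. v \<in> L \<and> u + v \<in> T)" for u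
  have r: "r u \<in> L \<and> u + r u \<in> T" if "u \<in> L" for u
    unfolding r_def by (rule someI[of _ u]) (use T that in auto)
  have r_eq: "r u = r u'" if "u + u' \<in> T" for u u'
  proof -
    have "u + v \<in> T \<longleftrightarrow> u' + v \<in> T" for v
      using T(2)[OF that, of "u + v"] T(2)[OF that, of "u' + v"] by (auto simp: ac_simps)
    then show ?thesis by (simp add: r_def)
  qed
  have inj: "r u = r u' \<and> t = t'" if "u \<in> L" "u' \<in> L" "t \<in> T" "t' \<in> T" "r u + t = r u' + t'" for u u' t t'
  proof -
    have "r u + r u' = t + t'" using that(5) by (metis K_double_left add.commute add.left_commute)
    moreover have "u + u' = ((u + r u) + (u' + r u')) + (r u + r u')" by (simp add: ac_simps)
    ultimately have "u + u' \<in> T" using r that T(2) by metis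
    then have "r u = r u'" by (rule r_eq)
    then show ?thesis using that(5) by simp
  qed
  have "bij_betw (\<lambda>(x, t). x + t) (r ` L \<times> T) L"
  proof (rule bij_betw_imageI)
    show "inj_on (\<lambda>(x, t). x + t) (r ` L \<times> T)" using inj by (auto simp: inj_on_def)
    have "u \<in> (\<lambda>(x, t). x + t) ` (r ` L \<times> T)" if "u \<in> L" for u
      using r[OF that] that by (intro image_eqI[of _ _ "(r u, u + r u)"]) (auto simp: ac_simps)
    then show "(\<lambda>(x, t). x + t) ` (r ` L \<times> T) = L" using r L T(3) by auto
  qed
  then show ?thesis by (rule that)
qed

section \<open>The twisted group algebra\<close>

text \<open>The condition says that \<open>om\<close> has trace 1. Hence
  \<open>Tr (om * u * cj u) = Nm u\<close> on \<open>L\<close>: the bilinear cocycle restricts to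
  the norm form on the diagonal.\<close>

locale trace_one = quadratic_extension +
  fixes om :: K
  assumes om: "cj om = 1 + om"
begin

lemma om_in_L [simp, intro]: "om \<in> L" by (simp add: L_def om)
lemma om_notin_M: "om \<notin> M" by (simp add: M_def om)
lemma Tr_om_mult: "m \<in> M \<Longrightarrow> Tr (om * m) = m" by (simp add: Tr_def om cj_M algebra_simps)

lemma sum_chi_Tr:
  assumes v: "v \<in> L" "v \<noteq> 0"
  shows "(\<Sum>u\<in>L. chi (Tr (u * v))) = 0"
proof -
  obtain m where m: "m \<in> M" "lam m \<noteq> 0" by (rule lam_nontrivial)
  \<comment> \<open>The witness satisfies \<open>Tr (om * m / v * v) = m\<close>, where
    \<open>chi\<close> is -1.\<close>
  show ?thesis
    by (rule sum_character_eq_0[of _ "om * m / v"])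
      (use v m in \<open>auto simp: distrib_right Tr_add chi_add Tr_om_mult M_in_L\<close>, auto simp: chi_def Tr_om_mult)
qed

text \<open>The coefficient of \<open>E w\<close> in \<open>D s * E v\<close>.\<close>

definition alg_kernel :: "K \<Rightarrow> K \<Rightarrow> K \<Rightarrow> real" where
  "alg_kernel s w v = - (1 / 2 ^ k) * chi (s * Nm (w + v) + Tr (om * (w + v) * cj v))"

section \<open>Products of the kernels by Gauss sums\<close>

text \<open>With the intermediate index written as \<open>u + w\<close>, the exponent is sorted by
  degree in \<open>u\<close>. The 1 in the leading coefficient comes from
  \<open>Tr (om * u * cj u) = Nm u\<close>.\<close>

lemma alg_kernel_exponent_mult:
  assumes s: "s \<in> M" "s' \<in> M" and L: "w \<in> L" "v \<in> L" "u \<in> L"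
  shows "(s * Nm u + Tr (om * u * cj (w + u))) + (s' * Nm (u + (w + v)) + Tr (om * (u + (w + v)) * cj v))
    = (1 + s + s') * Nm u + Tr (u * cj (w + v) * (s' + om)) + s' * Nm (w + v) + Tr (om * (w + v) * cj v)"
  using s L by (simp add: Nm_def Tr_def om cj_M cj_cj algebra_simps)

text \<open>For the shift \<open>y = x * cj z / \<sigma>\<close> the linear term becomes
  \<open>\<sigma> * Tr (p * cj y)\<close>, the polar term of \<open>\<sigma> * Nm\<close> between
  \<open>p\<close> and \<open>y\<close>. The two copies cancel in characteristic 2 and leave
  \<open>\<sigma> * Nm y\<close>.\<close>

lemma complete_square:
  assumes s: "\<sigma> \<in> M" "\<sigma> \<noteq> 0" and L: "p \<in> L" "x \<in> L" "z \<in> L"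
  shows "\<sigma> * Nm (p + x * cj z / \<sigma>) + Tr ((p + x * cj z / \<sigma>) * cj x * z)
    = \<sigma> * Nm p + (Nm z / \<sigma>) * Nm x"
proof -
  define y where "y = x * cj z / \<sigma>"
  have y: "x * cj z = \<sigma> * y" "cj x * z = \<sigma> * cj y" "y \<in> L"
    using s L by (auto simp: y_def cj_M cj_cj M_in_L)
  have "(Nm z / \<sigma>) * Nm x = (x * cj z) * (cj x * z) / \<sigma>"
    by (simp add: Nm_def)
  also have "\<dots> = \<sigma> * Nm y" using s unfolding y by (simp add: Nm_def)
  finally have 1: "(Nm z / \<sigma>) * Nm x = \<sigma> * Nm y" .
  have "Tr ((p + y) * cj x * z) = Tr ((p + y) * (cj x * z))" by (simp add: mult.assoc)
  also have "\<dots> = \<sigma> * Tr ((p + y) * cj y)" unfolding y using s by (simp add: Tr_def cj_M algebra_simps)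
  finally have 2: "Tr ((p + y) * cj x * z) = \<sigma> * Tr ((p + y) * cj y)" .
  show ?thesis
    unfolding 1 y_def[symmetric] 2 using y(3) by (simp add: Nm_def Tr_def cj_cj algebra_simps)
qed

lemma sum_shift_L: "c \<in> L \<Longrightarrow> (\<Sum>u\<in>L. f u) = (\<Sum>u\<in>L. f (u + c))"
  by (rule sum.reindex_bij_witness[of _ "\<lambda>u. u + c" "\<lambda>u. u + c"]) (auto simp: add.assoc)

lemma sum_alg_kernel_mult:
  assumes s: "s \<in> M" "s' \<in> M" and L: "w \<in> L" "v \<in> L"
  shows "(\<Sum>y\<in>L. alg_kernel s w y * alg_kernel s' y v) = (1 / 2 ^ k)\<^sup>2 *
    (\<Sum>u\<in>L. chi ((1 + s + s') * Nm u + Tr (u * cj (w + v) * (s' + om)))) *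
    chi (s' * Nm (w + v) + Tr (om * (w + v) * cj v))"
proof -
  have s'L: "s' \<in> L" using s by (simp add: M_in_L)
  have "alg_kernel s w (u + w) * alg_kernel s' (u + w) v = (1 / 2 ^ k)\<^sup>2 *
    chi ((1 + s + s') * Nm u + Tr (u * cj (w + v) * (s' + om))) *
    chi (s' * Nm (w + v) + Tr (om * (w + v) * cj v))" if u: "u \<in> L" for u
  proof -
    have "alg_kernel s w (u + w) * alg_kernel s' (u + w) v = (1 / 2 ^ k)\<^sup>2 *
       (chi (s * Nm u + Tr (om * u * cj (w + u))) *
        chi (s' * Nm (u + (w + v)) + Tr (om * (u + (w + v)) * cj v)))"
      by (simp add: alg_kernel_def power2_eq_square add.left_commute[of w u w] add.assoc add.commute[of u w])
        (simp add: ac_simps)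
    also have "chi (s * Nm u + Tr (om * u * cj (w + u))) *
        chi (s' * Nm (u + (w + v)) + Tr (om * (u + (w + v)) * cj v)) =
        chi ((1 + s + s') * Nm u + Tr (u * cj (w + v) * (s' + om)) + (s' * Nm (w + v) + Tr (om * (w + v) * cj v)))"
      using s L u alg_kernel_exponent_mult[OF s L u]
      by (subst chi_add[symmetric]) (auto simp: add.assoc simp del: cj_add intro: M_in_L)
    also have "\<dots> = chi ((1 + s + s') * Nm u + Tr (u * cj (w + v) * (s' + om))) *
        chi (s' * Nm (w + v) + Tr (om * (w + v) * cj v))"
      using s L u s'L by (intro chi_add) (simp_all del: cj_add)
    finally show ?thesis by (simp add: mult.assoc)
  qed
  then show ?thesis
    by (simp add: sum_shift_L[OF L(1), of "\<lambda>y. alg_kernel s w y * alg_kernel s' y v"] sum_distrib_left sum_distrib_right)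
qed

text \<open>Completing the square leaves the sum of \<open>chi (\<sigma> * Nm u)\<close>, which is
  \<open>- (2 ^ k)\<close>; against the squared prefactor this restores the normalization
  \<open>- (1 / 2 ^ k)\<close>.\<close>

lemma alg_kernel_mult:
  assumes s: "s \<in> M" "s' \<in> M" and ne: "1 + s + s' \<noteq> 0" and L: "w \<in> L" "v \<in> L"
  shows "(\<Sum>y\<in>L. alg_kernel s w y * alg_kernel s' y v) = alg_kernel (s' + Nm (s' + om) / (1 + s + s')) w v"
proof -
  define \<sigma> where "\<sigma> = 1 + s + s'"
  define c where "c = (w + v) * cj (s' + om) / \<sigma>"
  have \<sigma>: "\<sigma> \<in> M" "\<sigma> \<noteq> 0" using s ne by (auto simp: \<sigma>_def)
  have z: "s' + om \<in> L" using s by (auto intro: M_in_L)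
  have wv: "w + v \<in> L" using L by auto
  have c: "c \<in> L" unfolding c_def using \<sigma> z wv by (auto simp del: cj_add intro: M_in_L)
  have "(\<Sum>u\<in>L. chi (\<sigma> * Nm u + Tr (u * cj (w + v) * (s' + om))))
     = (\<Sum>u\<in>L. chi (\<sigma> * Nm (u + c) + Tr ((u + c) * cj (w + v) * (s' + om))))"
    by (rule sum_shift_L[OF c])
  also have "\<dots> = (\<Sum>u\<in>L. chi (\<sigma> * Nm u + (Nm (s' + om) / \<sigma>) * Nm (w + v)))"
    unfolding c_def by (intro sum.cong refl) (simp only: complete_square[OF \<sigma> _ wv z])
  also have "\<dots> = (\<Sum>u\<in>L. chi (\<sigma> * Nm u)) * chi ((Nm (s' + om) / \<sigma>) * Nm (w + v))"
    unfolding sum_distrib_right using \<sigma> z wv by (intro sum.cong refl chi_add) auto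
  also have "\<dots> = - (2 ^ k) * chi ((Nm (s' + om) / \<sigma>) * Nm (w + v))"
    by (simp only: sum_chi_Nm[OF \<sigma>])
  finally have 1: "(\<Sum>u\<in>L. chi (\<sigma> * Nm u + Tr (u * cj (w + v) * (s' + om)))) =
    - (2 ^ k) * chi ((Nm (s' + om) / \<sigma>) * Nm (w + v))" .
  have "chi ((Nm (s' + om) / \<sigma>) * Nm (w + v)) * chi (s' * Nm (w + v) + Tr (om * (w + v) * cj v))
    = chi ((Nm (s' + om) / \<sigma>) * Nm (w + v) + (s' * Nm (w + v) + Tr (om * (w + v) * cj v)))"
    by (rule chi_add[symmetric]) (use \<sigma> z wv s L in auto)
  also have "\<dots> = chi ((s' + Nm (s' + om) / \<sigma>) * Nm (w + v) + Tr (om * (w + v) * cj v))"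
    by (rule arg_cong[of _ _ chi]) (simp only: distrib_right add.assoc add.commute add.left_commute)
  finally have 2: "chi ((Nm (s' + om) / \<sigma>) * Nm (w + v)) * chi (s' * Nm (w + v) + Tr (om * (w + v) * cj v))
    = chi ((s' + Nm (s' + om) / \<sigma>) * Nm (w + v) + Tr (om * (w + v) * cj v))" .
  show ?thesis
    unfolding sum_alg_kernel_mult[OF s L] \<sigma>_def[symmetric] 1 alg_kernel_def[of _ w v] 2[symmetric]
    by (simp add: power2_eq_square del: cj_add)
qed

text \<open>For parameters \<open>s\<close> and \<open>1 + s\<close> the quadratic term vanishes.
  What remains is a character sum with linear coefficient \<open>cj (w + v) * (1 + s + om)\<close>,
  whose second factor is nonzero because \<open>om\<close> is outside \<open>M\<close>.\<close>

lemma alg_kernel_inverse: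
  assumes s: "s \<in> M" and L: "w \<in> L" "v \<in> L"
  shows "(\<Sum>y\<in>L. alg_kernel s w y * alg_kernel (1 + s) y v) = (if w = v then 1 else 0)"
proof -
  define z where "z = 1 + s + om"
  have z: "z \<in> L" unfolding z_def using s by (auto intro: M_in_L)
  have "z \<noteq> 0" 
  proof
    assume "z = 0"
    then have "om = 1 + s" by (simp add: z_def K_add_eq_0_iff)
    then show False using s om_notin_M by auto
  qed
  have "(\<Sum>u\<in>L. chi ((1 + s + (1 + s)) * Nm u + Tr (u * cj (w + v) * z))) = (if w = v then (2 ^ k)\<^sup>2 else 0)"
  proof (cases "w = v")
    case True
    then show ?thesis by (simp add: Tr_def card_L)
  next
    case False
    then have "cj (w + v) * z \<noteq> 0"
      using \<open>z \<noteq> 0\<close> by (simp only: mult_eq_0_iff cj_eq_0_iff K_add_eq_0_iff) simp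
    moreover have "cj (w + v) * z \<in> L" using z L by auto
    ultimately have "(\<Sum>u\<in>L. chi (Tr (u * (cj (w + v) * z)))) = 0" by (intro sum_chi_Tr)
    then show ?thesis using False by (simp add: mult.assoc del: cj_add)
  qed
  then show ?thesis
    unfolding sum_alg_kernel_mult[OF s M_closed(3)[OF M_closed(2) s] L] z_def[symmetric]
    by (auto simp: Nm_def Tr_def power2_eq_square)
qed

text \<open>Expresses that left multiplication by \<open>D s\<close> commutes with right
  multiplication by \<open>E t\<close>.\<close>

lemma alg_kernel_translate:
  assumes "s \<in> M" and L: "w \<in> L" "v \<in> L" and t: "t \<in> M"
  shows "alg_kernel s (w + t) (v + t) = alg_kernel s w v * chi (Tr (om * (w + v) * t))"
proof -
  have "s * Nm (w + v) + Tr (om * (w + v) * cj (v + t)) =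
     (s * Nm (w + v) + Tr (om * (w + v) * cj v)) + Tr (om * (w + v) * t)"
    using t by (simp add: Tr_def cj_M algebra_simps)
  moreover have "(w + t) + (v + t) = w + v" by (simp add: ac_simps)
  ultimately show ?thesis
    unfolding alg_kernel_def using assms by (simp only: chi_add M_closed Nm_in_M Tr_in_M L_closed om_in_L M_in_L mult.assoc)
qed

end

section \<open>The induced representation\<close>

text \<open>Since \<open>Tr (om * t * t') = t * t'\<close> for elements of \<open>M\<close>,
  \<open>phi_add\<close> says exactly that sending \<open>E t\<close> to \<open>phi t\<close> is
  multiplicative on \<open>T\<close>. \<open>S\<close> represents the cosets of \<open>T\<close> in
  \<open>L\<close>.\<close>

locale quadratic_transversal = trace_one +
  fixes T S :: "K set" and phi :: "K \<Rightarrow> real"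
  assumes T_subset_M: "T \<subseteq> M" and T_0: "0 \<in> T"
    and T_add: "\<And>t t'. t \<in> T \<Longrightarrow> t' \<in> T \<Longrightarrow> t + t' \<in> T"
    and chi_T: "\<And>t. t \<in> T \<Longrightarrow> chi t = 1"
    and phi_square: "\<And>t. t \<in> T \<Longrightarrow> phi t * phi t = 1"
    and phi_add: "\<And>t t'. t \<in> T \<Longrightarrow> t' \<in> T \<Longrightarrow> phi (t + t') = phi t * phi t' * chi (t * t')"
    and nondegenerate: "\<And>t. t \<in> T \<Longrightarrow> t \<noteq> 0 \<Longrightarrow> \<exists>t'\<in>T. chi (t * t') \<noteq> 1"
    and transversal: "bij_betw (\<lambda>(x, t). x + t) (S \<times> T) L"
begin

lemma T_in_M: "t \<in> T \<Longrightarrow> t \<in> M" using T_subset_M by auto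
lemma T_in_L: "t \<in> T \<Longrightarrow> t \<in> L" using T_in_M M_in_L by auto
lemma finite_T [simp]: "finite T" using T_subset_M finite_M finite_subset by blast

lemma S_in_L: "x \<in> S \<Longrightarrow> x \<in> L"
  using bij_betwE[OF transversal] T_0 by fastforce

lemma S_unique: "x \<in> S \<Longrightarrow> y \<in> S \<Longrightarrow> t \<in> T \<Longrightarrow> x + t = y \<Longrightarrow> x = y \<and> t = 0"
  using inj_onD[OF bij_betw_imp_inj_on[OF transversal], of "(x, t)" "(y, 0)"] T_0 by auto

lemma finite_S [simp]: "finite S" and card_S: "card S * card T = (2 ^ k)\<^sup>2"
proof -
  have "S \<subseteq> L" using S_in_L by auto
  then show "finite S" using finite_L finite_subset by blast
  show "card S * card T = (2 ^ k)\<^sup>2"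
    using bij_betw_same_card[OF transversal] by (simp add: card_cartesian_product card_L)
qed

lemma sum_transversal: "(\<Sum>x\<in>S. \<Sum>t\<in>T. f (x + t)) = (\<Sum>y\<in>L. f y)"
  using sum.reindex_bij_betw[OF transversal, of f]
  by (simp add: sum.cartesian_product split_def)

lemma sum_shift_T: "c \<in> T \<Longrightarrow> (\<Sum>t\<in>T. f (t + c)) = (\<Sum>t\<in>T. f t)"
  by (rule sum.reindex_bij_witness[of _ "\<lambda>u. u + c" "\<lambda>u. u + c"]) (auto simp: add.assoc T_add)

text \<open>In the module generated by a vector \<open>e\<close> with \<open>E t e = phi t e\<close> for \<open>t\<close> in \<open>T\<close>, one has
  \<open>E (w + t) e = theta w t E w e\<close>; so the \<open>E w e\<close> with \<open>w\<close> in \<open>S\<close> form a basis, in which \<open>ind_kernel s\<close>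
  is the matrix of \<open>D s\<close>.\<close>

definition theta :: "K \<Rightarrow> K \<Rightarrow> real" where "theta w t = phi t * chi (Tr (om * w * t))"

definition ind_kernel :: "K \<Rightarrow> K \<Rightarrow> K \<Rightarrow> real" where
  "ind_kernel s w v = (\<Sum>t\<in>T. alg_kernel s (w + t) v * theta w t)"

lemma phi_0 [simp]: "phi 0 = 1"
  using phi_add[OF T_0 T_0] phi_square[OF T_0] by simp

lemma theta_0 [simp]: "theta w 0 = 1" by (simp add: theta_def Tr_def)

lemma theta_add:
  assumes "w \<in> L" "x \<in> L" and t: "t \<in> T" "t' \<in> T"
  shows "theta w t * theta x t' * chi (Tr (om * (w + t + x) * t')) = theta w (t + t')"
proof -
  have tM: "t \<in> M" "t' \<in> M" "t \<in> L" "t' \<in> L" using t T_in_M T_in_L by auto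
  \<comment> \<open>The terms with \<open>x\<close> cancel in pairs; the extra \<open>t * t'\<close>
    is absorbed by \<open>phi_add\<close>.\<close>
  have "Tr (om * w * (t + t')) + t * t' = Tr (om * w * t) + Tr (om * x * t') + Tr (om * (w + t + x) * t')"
    using tM by (simp add: Tr_def om cj_M algebra_simps)
  then have "chi (Tr (om * w * (t + t'))) * chi (t * t') =
      chi (Tr (om * w * t)) * chi (Tr (om * x * t')) * chi (Tr (om * (w + t + x) * t'))"
    using assms tM by (simp flip: chi_add)
  then show ?thesis using t by (simp add: theta_def phi_add mult.assoc) (simp add: ac_simps)
qed

text \<open>Passing to the induced module respects products: \<open>P\<close> commutes with right
  multiplication by the \<open>E t\<close>, so its \<open>T\<close>-translates can be aligned with
  those of the second factor.\<close>

lemma sum_kernels: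
  assumes P: "\<And>w y t. w \<in> L \<Longrightarrow> y \<in> L \<Longrightarrow> t \<in> T \<Longrightarrow> P (w + t) (y + t) = P w y * chi (Tr (om * (w + y) * t))"
    and w: "w \<in> L"
  shows "(\<Sum>x\<in>S. (\<Sum>t\<in>T. P (w + t) x * theta w t) * (\<Sum>t\<in>T. R (x + t) v * theta x t))
    = (\<Sum>t\<in>T. (\<Sum>y\<in>L. P (w + t) y * R y v) * theta w t)"
proof -
  have summand: "P (w + t) x * theta w t * (R (x + t') v * theta x t') =
      P (w + (t + t')) (x + t') * R (x + t') v * theta w (t + t')"
    if "x \<in> S" "t \<in> T" "t' \<in> T" for x t t'
  proof -
    have "P (w + (t + t')) (x + t') = P (w + t) x * chi (Tr (om * (w + t + x) * t'))"
      using P[of "w + t" x t'] that w S_in_L T_in_L by (simp add: add.assoc)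
    then have "P (w + (t + t')) (x + t') * chi (Tr (om * (w + t + x) * t')) = P (w + t) x"
      by (simp add: mult.assoc)
    moreover have "theta w t * theta x t' * chi (Tr (om * (w + t + x) * t')) = theta w (t + t')"
      using that w by (intro theta_add) (auto simp: S_in_L)
    moreover have "q * a * (r' * b) = p * r' * d" if "p * c = q" "a * b * c = d" for a b c d p q r' :: real
      using that by auto
    ultimately show ?thesis by blast
  qed
  have "(\<Sum>x\<in>S. (\<Sum>t\<in>T. P (w + t) x * theta w t) * (\<Sum>t\<in>T. R (x + t) v * theta x t))
    = (\<Sum>x\<in>S. \<Sum>t'\<in>T. \<Sum>t\<in>T. P (w + (t + t')) (x + t') * R (x + t') v * theta w (t + t'))"
    unfolding sum_product
    by (rule sum.cong[OF refl], subst sum.swap, intro sum.cong refl) (rule summand)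
  \<comment> \<open>Replacing \<open>t + t'\<close> by \<open>t\<close> leaves \<open>t'\<close>
    only in \<open>x + t'\<close>, so the sums over \<open>S\<close> and \<open>T\<close> merge into
    one over \<open>L\<close>.\<close>
  also have "\<dots> = (\<Sum>x\<in>S. \<Sum>t'\<in>T. \<Sum>t\<in>T. P (w + t) (x + t') * R (x + t') v * theta w t)"
    by (intro sum.cong refl sum_shift_T)
  also have "\<dots> = (\<Sum>y\<in>L. \<Sum>t\<in>T. P (w + t) y * R y v * theta w t)"
    by (rule sum_transversal)
  also have "\<dots> = (\<Sum>t\<in>T. (\<Sum>y\<in>L. P (w + t) y * R y v) * theta w t)"
    by (subst sum.swap) (simp add: sum_distrib_right)
  finally show ?thesis .
qed

lemma ind_kernel_mult:
  assumes s: "s \<in> M" "s' \<in> M" and ne: "1 + s + s' \<noteq> 0" and S: "w \<in> S" "v \<in> S"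
  shows "(\<Sum>x\<in>S. ind_kernel s w x * ind_kernel s' x v) = ind_kernel (s' + Nm (s' + om) / (1 + s + s')) w v"
  unfolding ind_kernel_def using s S
  by (subst sum_kernels) (auto simp: alg_kernel_translate T_in_M T_in_L S_in_L alg_kernel_mult[OF s ne])

lemma ind_kernel_inverse:
  assumes s: "s \<in> M" and S: "w \<in> S" "v \<in> S"
  shows "(\<Sum>x\<in>S. ind_kernel s w x * ind_kernel (1 + s) x v) = (if w = v then 1 else 0)"
proof -
  have "(\<Sum>x\<in>S. ind_kernel s w x * ind_kernel (1 + s) x v) = (\<Sum>t\<in>T. (if w + t = v then 1 else 0) * theta w t)"
    unfolding ind_kernel_def using s S
    by (subst sum_kernels) (auto simp: alg_kernel_translate T_in_M T_in_L S_in_L alg_kernel_inverse)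
  \<comment> \<open>Different elements of \<open>S\<close> lie in different cosets, so
    \<open>w + t = v\<close> forces \<open>t = 0\<close>.\<close>
  also have "\<dots> = (\<Sum>t\<in>T. if t = 0 then if w = v then 1 else 0 else 0)"
    by (intro sum.cong) (use S_unique[OF S] in auto)
  finally show ?thesis using T_0 by simp
qed

text \<open>Combined with \<open>ind_kernel_inverse\<close> this makes the matrices orthogonal.
  Exchanging \<open>w\<close> and \<open>v\<close> changes the exponent by \<open>t * t\<close>, on
  which \<open>chi\<close> is 1 because \<open>t\<close> and its square have the same absolute
  trace, namely 0.\<close>

lemma ind_kernel_swap:
  assumes s: "s \<in> M" and S: "w \<in> S" "v \<in> S"
  shows "ind_kernel (1 + s) v w = ind_kernel s w v"
  unfolding ind_kernel_def
proof (intro sum.cong refl)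
  fix t assume t: "t \<in> T"
  note L = S_in_L[OF S(1)] S_in_L[OF S(2)] T_in_L[OF t] T_in_M[OF t]
  define e where "e = s * Nm (w + t + v) + Tr (om * (w + t + v) * cj v) + Tr (om * w * t)"
  define e' where "e' = (1 + s) * Nm (v + t + w) + Tr (om * (v + t + w) * cj w) + Tr (om * v * t)"
  have "e' = e + t * t"
    unfolding e_def e'_def using L s by (simp add: Nm_def Tr_def om cj_M cj_cj algebra_simps)
  moreover have "chi (t * t) = 1"
    using chi_T[OF t] lam_square_M[OF L(4)] by (simp add: chi_def power2_eq_square)
  moreover have "e \<in> M" unfolding e_def using L s by auto
  ultimately have "chi e' = chi e" using L by (simp add: chi_add)
  moreover have "chi e = chi (s * Nm (w + t + v) + Tr (om * (w + t + v) * cj v)) * chi (Tr (om * w * t))"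
    unfolding e_def using L s by (intro chi_add) auto
  moreover have "chi e' = chi ((1 + s) * Nm (v + t + w) + Tr (om * (v + t + w) * cj w)) * chi (Tr (om * v * t))"
    unfolding e'_def using L s by (intro chi_add) auto
  ultimately show "alg_kernel (1 + s) (v + t) w * theta v t = alg_kernel s (w + t) v * theta w t"
    unfolding alg_kernel_def theta_def by (simp only: mult.assoc mult.left_commute[of _ "phi t"])
qed

text \<open>Up to the prefactor the entry is a quadratic Gauss sum over \<open>T\<close>. Squaring
  it and summing over one variable first leaves, by nondegeneracy, only the terms with
  \<open>t' = 0\<close>.\<close>

lemma ind_kernel_square:
  assumes s: "s \<in> M" and S: "w \<in> S" "v \<in> S"
  shows "(ind_kernel s w v)\<^sup>2 = card T / (2 ^ k)\<^sup>2"
proof -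
  note L = S_in_L[OF S(1)] S_in_L[OF S(2)]
  define e where "e t = s * Nm (w + t + v) + Tr (om * (w + t + v) * cj v) + Tr (om * w * t)" for t
  define h where "h t = chi (e t) * phi t" for t
  have eM: "e t \<in> M" if "t \<in> T" for t unfolding e_def using that L s T_in_L by auto
  have ind_kernel: "ind_kernel s w v = - (1 / 2 ^ k) * (\<Sum>t\<in>T. h t)"
    unfolding ind_kernel_def sum_distrib_left
  proof (intro sum.cong refl)
    fix t assume t: "t \<in> T"
    have "chi (e t) = chi (s * Nm (w + t + v) + Tr (om * (w + t + v) * cj v)) * chi (Tr (om * w * t))"
      unfolding e_def using L s T_in_L[OF t] by (intro chi_add) auto
    then show "alg_kernel s (w + t) v * theta w t = - (1 / 2 ^ k) * h t"
      by (simp add: alg_kernel_def theta_def h_def)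
  qed
  have h: "h t * h (t + t') = h 0 * h t' * chi (t * t')" if t: "t \<in> T" "t' \<in> T" for t t'
  proof -
    note tL = T_in_L[OF t(1)] T_in_L[OF t(2)] T_in_M[OF t(1)] T_in_M[OF t(2)]
    \<comment> \<open>\<open>e\<close> is affine on \<open>T\<close>, since \<open>t * t\<close> is
      additive in characteristic 2; the only nontrivial polar form comes from
      \<open>phi\<close>.\<close>
    have "e t + e (t + t') = e 0 + e t'"
      unfolding e_def using L s tL by (simp add: Nm_def Tr_def om cj_M cj_cj algebra_simps)
    then have "chi (e t) * chi (e (t + t')) = chi (e 0) * chi (e t')"
      using eM t T_add T_0 by (simp flip: chi_add)
    moreover have "h t * h (t + t') = (chi (e t) * chi (e (t + t'))) * (phi t * phi t) * phi t' * chi (t * t')"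
      by (simp add: h_def phi_add[OF t])
    ultimately show ?thesis by (simp add: h_def phi_square t)
  qed
  have orth: "(\<Sum>t\<in>T. chi (t * t')) = (if t' = 0 then card T else 0)" if t': "t' \<in> T" for t'
  proof (cases "t' = 0")
    case False
    then obtain r where r: "r \<in> T" "chi (r * t') \<noteq> 1"
      using nondegenerate[OF t'] by (auto simp: mult.commute)
    have "(\<Sum>t\<in>T. chi (t * t')) = 0"
      by (rule sum_character_eq_0[of _ r])
        (use r t' in \<open>auto simp: distrib_right T_add chi_add T_in_M\<close>)
    then show ?thesis using False by simp
  qed simp
  have "(\<Sum>t\<in>T. h t)\<^sup>2 = (\<Sum>t\<in>T. \<Sum>t'\<in>T. h t * h (t' + t))"
    unfolding power2_eq_square sum_product
    by (intro sum.cong refl sum_shift_T[symmetric, where f = "\<lambda>x. h _ * h x"])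
  also have "\<dots> = (\<Sum>t'\<in>T. h 0 * h t' * (\<Sum>t\<in>T. chi (t * t')))"
    unfolding sum_distrib_left by (subst sum.swap, intro sum.cong refl) (metis h add.commute)
  also have "\<dots> = (\<Sum>t'\<in>T. if t' = 0 then h 0 * h 0 * card T else 0)"
    by (intro sum.cong refl) (auto simp: orth)
  also have "\<dots> = card T" using T_0 by (simp add: h_def)
  finally show ?thesis by (simp add: ind_kernel power_mult_distrib power_divide)
qed

section \<open>Parametrization by the norm-one group\<close>

definition G :: "K set" where "G = {x. x ^ (2 ^ k + 1) = 1}"

lemma G_closed: "1 \<in> G" "x \<in> G \<Longrightarrow> y \<in> G \<Longrightarrow> x * y \<in> G" "x \<in> G \<Longrightarrow> inverse x \<in> G" "x \<in> G \<Longrightarrow> x ^ n \<in> G"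
proof -
  show "1 \<in> G" by (simp add: G_def)
  show "x * y \<in> G" if "x \<in> G" "y \<in> G"
    using that unfolding G_def mem_Collect_eq power_mult_distrib by simp
  show "inverse x \<in> G" if "x \<in> G"
    using that unfolding G_def mem_Collect_eq power_inverse by simp
  show "x ^ n \<in> G" if "x \<in> G"
    using that unfolding G_def mem_Collect_eq by (metis power_mult mult.commute power_one)
qed

lemma G_nonzero: "x \<in> G \<Longrightarrow> x \<noteq> 0" by (auto simp: G_def)

lemma cj_G: "x \<in> G \<Longrightarrow> cj x = inverse x"
  using inverse_unique[of x "cj x"] by (simp add: G_def cj_def)

definition par :: "K \<Rightarrow> K" where "par x = 1 / (1 + x) + om"

text \<open>At \<open>x = 1\<close> division by zero makes \<open>par\<close> equal to
  \<open>om\<close>, outside \<open>M\<close>, so the identity is supplied separately.\<close>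

definition grp_kernel :: "K \<Rightarrow> K \<Rightarrow> K \<Rightarrow> real" where
  "grp_kernel x w v = (if x = 1 then if w = v then 1 else 0 else ind_kernel (par x) w v)"

text \<open>For a norm-one \<open>x\<close> other than 1, \<open>1 / (1 + x)\<close> has trace 1
  like \<open>om\<close>, so their sum is fixed by \<open>cj\<close>.\<close>

lemma par_in_M:
  assumes x: "x \<in> G" "x \<noteq> 1" shows "par x \<in> M"
proof -
  have ne: "1 + x \<noteq> 0" "x \<noteq> 0" using x G_nonzero by (auto simp: K_add_eq_0_iff)
  have "cj (par x) = 1 / (1 + inverse x) + (1 + om)" by (simp add: par_def om cj_G x)
  also have "1 / (1 + inverse x) = x / (1 + x)" using ne by (simp add: field_simps)
  also have "x / (1 + x) = 1 + 1 / (1 + x)" using ne by (simp add: field_simps)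
  finally show ?thesis by (simp add: par_def M_def ac_simps)
qed

lemma par_inverse:
  assumes x: "x \<in> G" "x \<noteq> 1" shows "par (inverse x) = 1 + par x"
proof -
  have ne: "1 + x \<noteq> 0" "x \<noteq> 0" using x G_nonzero by (auto simp: K_add_eq_0_iff)
  have "1 / (1 + inverse x) = 1 + 1 / (1 + x)" using ne by (simp add: field_simps)
  then show ?thesis by (simp add: par_def ac_simps)
qed

text \<open>Turns the composition law of \<open>ind_kernel_mult\<close> into multiplication in
  \<open>G\<close>. In terms of \<open>a = 1 + x\<close> and \<open>b = 1 + y\<close> it is an
  identity of rational functions, because \<open>par y + om = 1 / b\<close> and
  \<open>cj b = b / y\<close>.\<close>

lemma par_mult:
  assumes x: "x \<in> G" "x \<noteq> 1" and y: "y \<in> G" "y \<noteq> 1" and xy: "x * y \<noteq> 1"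
  shows "1 + par x + par y \<noteq> 0"
    and "par y + Nm (par y + om) / (1 + par x + par y) = par (x * y)"
proof -
  define a b where "a = 1 + x" and "b = 1 + y"
  have ne: "a \<noteq> 0" "b \<noteq> 0" using x y by (auto simp: K_add_eq_0_iff a_def b_def)
  have x': "x = 1 + a" and y': "y = 1 + b" by (simp_all add: a_def b_def)
  have c: "1 + x * y = a * b + a + b" by (simp add: x' y' algebra_simps)
  have c0: "a * b + a + b \<noteq> 0" using xy by (simp flip: c add: K_add_eq_0_iff)
  have s: "1 + par x + par y = (a * b + a + b) / (a * b)"
    using ne by (simp add: par_def ac_simps flip: a_def b_def) (simp add: field_simps)
  then show "1 + par x + par y \<noteq> 0" using c0 ne by simp
  have "cj b = inverse y * b" using G_nonzero[OF y(1)] by (simp add: b_def cj_G y field_simps)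
  then have Nm: "Nm (par y + om) = (1 + b) / (b * b)"
    using G_nonzero[OF y(1)] ne by (simp add: par_def Nm_def add.assoc flip: b_def) (simp add: field_simps y')
  have "(1 + b) / (b * b) / (c / (a * b)) = (((1 + b) * a) * b) / ((b * c) * b)" for c
    by (simp only: divide_divide_eq_left divide_divide_eq_right times_divide_eq_left times_divide_eq_right ac_simps)
  then have "(1 + b) / (b * b) / (c / (a * b)) = (1 + b) * a / (b * c)" for c
    by (simp only: nonzero_mult_divide_mult_cancel_right ne not_False_eq_True)
  then have "Nm (par y + om) / (1 + par x + par y) = (1 + b) * a / (b * (a * b + a + b))"
    unfolding s Nm .
  moreover have "1 / b + (1 + b) * a / (b * (a * b + a + b)) = 1 / (a * b + a + b)"
    using ne c0 by (simp add: divide_simps) (simp add: algebra_simps)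
  ultimately show "par y + Nm (par y + om) / (1 + par x + par y) = par (x * y)"
    by (simp add: par_def c add.left_commute add.commute flip: b_def)
qed

text \<open>The case \<open>x * y = 1\<close> is separate because there
  \<open>1 + par x + par y\<close> vanishes and \<open>ind_kernel_inverse\<close> replaces the Gauss
  sum.\<close>

lemma grp_kernel_mult:
  assumes x: "x \<in> G" and y: "y \<in> G" and S: "w \<in> S" "v \<in> S"
  shows "(\<Sum>u\<in>S. grp_kernel x w u * grp_kernel y u v) = grp_kernel (x * y) w v"
proof -
  consider "x = 1" | "y = 1" | "x \<noteq> 1" "y \<noteq> 1" "x * y = 1" | "x \<noteq> 1" "y \<noteq> 1" "x * y \<noteq> 1" by blast
  then show ?thesis
  proof cases
    case 1
    then have "grp_kernel x w u * grp_kernel y u v = (if u = w then grp_kernel y w v else 0)" for u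
      by (auto simp: grp_kernel_def)
    then show ?thesis using 1 S by simp
  next
    case 2
    then have "grp_kernel x w u * grp_kernel y u v = (if u = v then grp_kernel x w v else 0)" for u
      by (auto simp: grp_kernel_def)
    then show ?thesis using 2 S by simp
  next
    case 3
    have "y = inverse x" using 3 inverse_unique by metis
    then show ?thesis
      using 3 x S by (simp add: grp_kernel_def par_inverse ind_kernel_inverse par_in_M)
  next
    case 4
    then show ?thesis
      using x y S ind_kernel_mult[OF par_in_M par_in_M par_mult(1)] by (simp add: grp_kernel_def par_mult(2))
  qed
qed

lemma grp_kernel_inverse:
  assumes "x \<in> G" "w \<in> S" "v \<in> S"
  shows "grp_kernel (inverse x) v w = grp_kernel x w v"
  using assms by (auto simp: grp_kernel_def par_inverse par_in_M ind_kernel_swap)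

lemma grp_kernel_square:
  assumes "x \<in> G" "x \<noteq> 1" "w \<in> S" "v \<in> S"
  shows "(grp_kernel x w v)\<^sup>2 = 1 / card S"
proof -
  have "real (card T) \<noteq> 0" using T_0 by auto
  moreover have "real (card S) * real (card T) = (2 ^ k)\<^sup>2"
    using arg_cong[OF card_S, of real] by simp
  ultimately have "real (card T) / (2 ^ k)\<^sup>2 = 1 / card S"
    by (metis nonzero_divide_mult_cancel_right)
  then show ?thesis using assms by (simp add: grp_kernel_def ind_kernel_square par_in_M)
qed

section \<open>Matrices over an enumeration of the transversal\<close>

definition matD :: "nat \<Rightarrow> (nat \<Rightarrow> K) \<Rightarrow> K \<Rightarrow> real mat" where
  "matD d h x = mat d d (\<lambda>(i, j). grp_kernel x (h i) (h j))"

lemma matD_carrier [simp]: "matD d h x \<in> carrier_mat d d"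
  by (simp add: matD_def)

lemma matD_mult:
  assumes h: "bij_betw h {..<d} S" and G: "x \<in> G" "y \<in> G"
  shows "matD d h x * matD d h y = matD d h (x * y)"
proof (rule eq_matI)
  fix i j assume "i < dim_row (matD d h (x * y))" "j < dim_col (matD d h (x * y))"
  then have ij: "i < d" "j < d" by (simp_all add: matD_def)
  then have hS: "h i \<in> S" "h j \<in> S" using bij_betwE[OF h] by auto
  have "(matD d h x * matD d h y) $$ (i, j) = (\<Sum>l<d. grp_kernel x (h i) (h l) * grp_kernel y (h l) (h j))"
    using ij by (simp add: matD_def scalar_prod_def lessThan_atLeast0)
  also have "\<dots> = (\<Sum>u\<in>S. grp_kernel x (h i) u * grp_kernel y u (h j))"
    by (rule sum.reindex_bij_betw[OF h])
  also have "\<dots> = matD d h (x * y) $$ (i, j)"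
    using ij grp_kernel_mult[OF G hS] by (simp add: matD_def)
  finally show "(matD d h x * matD d h y) $$ (i, j) = matD d h (x * y) $$ (i, j)" .
qed (simp_all add: matD_def)

lemma matD_1:
  assumes h: "bij_betw h {..<d} S" shows "matD d h 1 = 1\<^sub>m d"
  by (rule eq_matI)
    (auto simp: matD_def grp_kernel_def inj_on_eq_iff[OF bij_betw_imp_inj_on[OF h]])

lemma matD_pow:
  assumes h: "bij_betw h {..<d} S" and x: "x \<in> G"
  shows "matD d h x ^\<^sub>m n = matD d h (x ^ n)"
proof (induction n)
  case 0
  then show ?case by (simp add: matD_1[OF h]) (simp add: matD_def)
next
  case (Suc n)
  have "matD d h x ^\<^sub>m Suc n = matD d h (x ^ n) * matD d h x" by (simp add: Suc)
  also have "\<dots> = matD d h (x ^ n * x)" by (rule matD_mult[OF h G_closed(4)[OF x] x])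
  finally show ?case by (simp only: power_Suc2)
qed

lemma real_orthogonal_mat_matD:
  assumes h: "bij_betw h {..<d} S" and x: "x \<in> G"
  shows "real_orthogonal_mat d (matD d h x)"
proof -
  have "(matD d h x)\<^sup>T = matD d h (inverse x)"
    using bij_betwE[OF h] x by (intro eq_matI) (auto simp: matD_def grp_kernel_inverse)
  then show ?thesis
    using x G_nonzero[OF x] by (simp add: real_orthogonal_mat_def matD_mult[OF h] G_closed matD_1[OF h])
qed

lemma matD_entry_square:
  assumes h: "bij_betw h {..<d} S" and x: "x \<in> G" "x \<noteq> 1" and ij: "i < d" "j < d"
  shows "(matD d h x $$ (i, j))\<^sup>2 = 1 / d"
  using bij_betwE[OF h] bij_betw_same_card[OF h] assms by (simp add: matD_def grp_kernel_square)

end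

section \<open>Orthogonal matrices and unbiased bases\<close>

lemma real_orthogonal_mat_mult:
  assumes A: "real_orthogonal_mat d A" and B: "real_orthogonal_mat d B"
  shows "real_orthogonal_mat d (A * B)"
proof -
  have c: "A \<in> carrier_mat d d" "A\<^sup>T \<in> carrier_mat d d" "B \<in> carrier_mat d d" "B\<^sup>T \<in> carrier_mat d d"
    using A B by (auto simp: real_orthogonal_mat_def)
  have cancel: "(P * Q) * (Q' * P') = 1\<^sub>m d"
    if "P \<in> carrier_mat d d" "P' \<in> carrier_mat d d" "Q \<in> carrier_mat d d" "Q' \<in> carrier_mat d d"
      "P * P' = 1\<^sub>m d" "Q * Q' = 1\<^sub>m d" for P P' Q Q' :: "real mat"
  proof -
    have "Q * (Q' * P') = P'"
      using that by (simp flip: assoc_mult_mat[OF that(3,4,2)])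
    then show ?thesis
      using that by (simp add: assoc_mult_mat[OF that(1,3) mult_carrier_mat[OF that(4,2)]])
  qed
  have "(A * B)\<^sup>T = B\<^sup>T * A\<^sup>T" by (rule transpose_mult[OF c(1,3)])
  then show ?thesis
    using cancel[of A "A\<^sup>T" B "B\<^sup>T"] cancel[of "B\<^sup>T" B "A\<^sup>T" A] A B c
    by (auto simp: real_orthogonal_mat_def)
qed

lemma real_orthogonal_mat_pow:
  assumes "real_orthogonal_mat d A" shows "real_orthogonal_mat d (A ^\<^sub>m n)"
proof (induction n)
  case 0
  then show ?case using assms by (auto simp: real_orthogonal_mat_def)
next
  case (Suc n)
  then show ?case using assms by (simp add: real_orthogonal_mat_mult)
qed

text \<open>Orthonormality makes the \<open>d\<close> rows distinct and the nonzero determinant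
  makes them independent; by dimension they form a basis.\<close>

lemma orthonormal_basis_rows:
  assumes A: "real_orthogonal_mat d A"
  shows "orthonormal_basis d (basis_of_mat A)"
proof -
  interpret vec_space "TYPE(real)" d .
  have c: "A \<in> carrier_mat d d" "A * A\<^sup>T = 1\<^sub>m d"
    using A by (auto simp: real_orthogonal_mat_def)
  have inner: "row A i \<bullet> row A j = (if i = j then 1 else 0)" if "i < d" "j < d" for i j
    using arg_cong[OF c(2), of "\<lambda>B. B $$ (i, j)"] that c(1) by simp
  have "distinct (rows A)"
  proof (unfold distinct_conv_nth, intro allI impI)
    fix i j assume "i < length (rows A)" "j < length (rows A)" "i \<noteq> j"
    then show "rows A ! i \<noteq> rows A ! j"
      using inner[of i i] inner[of i j] c(1) by auto
  qed
  then have card: "card (set (rows A)) = d" using c(1) by (simp add: distinct_card)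
  have "det A * det A\<^sup>T = 1" using c by (metis det_mult det_one transpose_carrier_mat)
  then have "lin_indpt (set (rows A))"
    by (intro det_not_0_imp_lin_indpt_rows c) auto
  then have "basis (set (rows A))"
    using card c(1) rows_carrier[of A] by (intro dim_li_is_basis) (auto simp: dim_is_n)
  moreover have "u \<bullet> v = (if u = v then 1 else 0)" if uv: "u \<in> set (rows A)" "v \<in> set (rows A)" for u v
  proof -
    obtain i j where "i < d" "j < d" "u = row A i" "v = row A j"
      using uv c(1) by (auto simp: rows_def)
    then show ?thesis using inner[of i j] inner[of i i] by auto
  qed
  ultimately show ?thesis by (simp add: orthonormal_basis_def basis_of_mat_def)
qed

lemma mutually_unbiased_rows:
  assumes A: "real_orthogonal_mat d A" and B: "real_orthogonal_mat d B"
    and AB: "\<And>i j. i < d \<Longrightarrow> j < d \<Longrightarrow> ((A * B\<^sup>T) $$ (i, j))\<^sup>2 = 1 / d"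
  shows "mutually_unbiased d (basis_of_mat A) (basis_of_mat B)"
  unfolding mutually_unbiased_def
proof (intro conjI ballI orthonormal_basis_rows A B)
  fix u v assume uv: "u \<in> basis_of_mat A" "v \<in> basis_of_mat B"
  have c: "A \<in> carrier_mat d d" "B \<in> carrier_mat d d"
    using A B by (auto simp: real_orthogonal_mat_def)
  obtain i j where ij: "i < d" "j < d" "u = row A i" "v = row B j"
    using uv c by (auto simp: basis_of_mat_def rows_def)
  then have "u \<bullet> v = (A * B\<^sup>T) $$ (i, j)" using c by simp
  then show "(u \<bullet> v)\<^sup>2 = 1 / real d" using AB ij by simp
qed

lemma pow_mat_add:
  assumes "A \<in> carrier_mat d d" shows "A ^\<^sub>m (m + n) = A ^\<^sub>m m * A ^\<^sub>m n"
  by (induction n) (use assms in \<open>auto simp: assoc_mult_mat[of _ d d _ d _ d]\<close>)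

text \<open>Indices in \<open>{1..N}\<close> differ by less than \<open>N\<close>, and
  \<open>D ^\<^sub>m a\<close> times the transpose of \<open>D ^\<^sub>m b\<close> is a power of
  \<open>D\<close> or its transpose, so only the entries of the powers below \<open>N\<close>
  matter. As \<open>d > 1\<close>, an entry of square \<open>1 / d\<close> cannot be a diagonal
  1.\<close>

lemma cyclic_mubs:
  assumes D: "real_orthogonal_mat d D" and d: "d > 1"
    and entries: "\<And>n i j. 0 < n \<Longrightarrow> n < N \<Longrightarrow> i < d \<Longrightarrow> j < d \<Longrightarrow> ((D ^\<^sub>m n) $$ (i, j))\<^sup>2 = 1 / d"
  shows "\<And>n. 0 < n \<Longrightarrow> n < N \<Longrightarrow> D ^\<^sub>m n \<noteq> 1\<^sub>m d"
    and "defines_mubs d {1..N} (\<lambda>n. D ^\<^sub>m n)"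
    and "inj_on (\<lambda>n. D ^\<^sub>m n) {1..N}"
proof -
  have c: "D \<in> carrier_mat d d" using D by (simp add: real_orthogonal_mat_def)
  show ne: "D ^\<^sub>m n \<noteq> 1\<^sub>m d" if "0 < n" "n < N" for n
    using entries[OF that, of 0 0] d by auto
  have quotient: "D ^\<^sub>m (m + n) * (D ^\<^sub>m m)\<^sup>T = D ^\<^sub>m n" for m n
  proof -
    have m: "D ^\<^sub>m m * (D ^\<^sub>m m)\<^sup>T = 1\<^sub>m d"
      using real_orthogonal_mat_pow[OF D] by (simp add: real_orthogonal_mat_def)
    have "D ^\<^sub>m (m + n) * (D ^\<^sub>m m)\<^sup>T = D ^\<^sub>m n * (D ^\<^sub>m m * (D ^\<^sub>m m)\<^sup>T)"
      using c by (subst add.commute) (simp add: pow_mat_add[OF c] assoc_mult_mat[of _ d d _ d _ d])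
    then show ?thesis using c m by simp
  qed
  have entries': "((D ^\<^sub>m a * (D ^\<^sub>m b)\<^sup>T) $$ (i, j))\<^sup>2 = 1 / d"
    if ab: "a \<in> {1..N}" "b \<in> {1..N}" "a \<noteq> b" and ij: "i < d" "j < d" for a b i j
  proof (cases "b < a")
    case True
    then show ?thesis using quotient[of b "a - b"] entries[of "a - b" i j] ab ij by simp
  next
    case False
    have "D ^\<^sub>m a * (D ^\<^sub>m b)\<^sup>T = (D ^\<^sub>m b * (D ^\<^sub>m a)\<^sup>T)\<^sup>T"
      using c by (simp add: transpose_mult[of _ d d _ d])
    also have "\<dots> = (D ^\<^sub>m (b - a))\<^sup>T" using quotient[of a "b - a"] False by simp
    finally show ?thesis
      using entries[of "b - a" j i] ab ij c False by simp
  qed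
  show "defines_mubs d {1..N} (\<lambda>n. D ^\<^sub>m n)"
    unfolding defines_mubs_def
    by (intro conjI ballI impI mutually_unbiased_rows real_orthogonal_mat_pow D entries') auto
  show "inj_on (\<lambda>n. D ^\<^sub>m n) {1..N}"
  proof (rule inj_onI, rule ccontr)
    fix a b assume ab: "a \<in> {1..N}" "b \<in> {1..N}" "D ^\<^sub>m a = D ^\<^sub>m b" "a \<noteq> b"
    have "D ^\<^sub>m a * (D ^\<^sub>m b)\<^sup>T = 1\<^sub>m d"
      using real_orthogonal_mat_pow[OF D, of b] ab(3) by (simp add: real_orthogonal_mat_def)
    then show False using entries'[OF ab(1,2,4), of 0 0] d by simp
  qed
qed

lemma real_hadamard_mat_smult:
  assumes A: "real_orthogonal_mat d A" and c: "real d = c\<^sup>2" "c > 0"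
    and entries: "\<And>i j. i < d \<Longrightarrow> j < d \<Longrightarrow> (A $$ (i, j))\<^sup>2 = 1 / d"
  shows "real_hadamard_mat d (c \<cdot>\<^sub>m A)"
proof -
  have A': "A \<in> carrier_mat d d" "A * A\<^sup>T = 1\<^sub>m d" using A by (auto simp: real_orthogonal_mat_def)
  have "(c \<cdot>\<^sub>m A) * (c \<cdot>\<^sub>m A)\<^sup>T = c\<^sup>2 \<cdot>\<^sub>m (A * A\<^sup>T)"
    using A'(1) by (intro eq_matI) (auto simp: scalar_prod_def power2_eq_square sum_distrib_left algebra_simps)
  moreover have "(c \<cdot>\<^sub>m A) $$ (i, j) = 1 \<or> (c \<cdot>\<^sub>m A) $$ (i, j) = -1" if "i < d" "j < d" for i j
  proof -
    have "(c * A $$ (i, j))\<^sup>2 = 1" using entries[OF that] c that by (simp add: power_mult_distrib)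
    then show ?thesis using that A'(1) by (simp add: power2_eq_1_iff)
  qed
  ultimately show ?thesis using A' c by (simp add: real_hadamard_mat_def)
qed

section \<open>Assembly of the cyclic matrix\<close>

lemma exists_cyclic_orthogonal_mat:
  assumes k: "k = a * n" and a: "a > 0" and n: "odd n" and d: "d = 2 ^ (a * (n + 1))"
  obtains D where "real_orthogonal_mat d D" "D ^\<^sub>m (2 ^ k + 1) = 1\<^sub>m d"
    "\<And>m i j. 0 < m \<Longrightarrow> m < 2 ^ k + 1 \<Longrightarrow> i < d \<Longrightarrow> j < d \<Longrightarrow> ((D ^\<^sub>m m) $$ (i, j))\<^sup>2 = 1 / d"
proof -
  have k0: "k > 0" using k a n by (auto intro: odd_pos)
  interpret quadratic_extension k by unfold_locales (rule k0)
  obtain g :: K where g: "g ^ (2 ^ k + 1) = 1" "\<And>e. 0 < e \<Longrightarrow> g ^ e = 1 \<Longrightarrow> 2 ^ k + 1 \<le> e"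
    by (rule norm_one_generator) blast
  have "(1::nat) < 2 ^ k" by (rule one_less_power[OF _ k0]) simp
  then have g1: "g \<noteq> 1" using g(2)[of 1] by auto
  \<comment> \<open>\<open>1 / (1 + g)\<close> has trace 1 because \<open>g\<close> has norm 1 and
    differs from 1.\<close>
  define om where "om = 1 / (1 + g)"
  have cjg: "cj g = inverse g"
    using g(1) inverse_unique[of g "cj g"] by (simp add: cj_def)
  have om: "cj om = 1 + om"
  proof -
    have ne: "1 + g \<noteq> 0" "g \<noteq> 0" using g1 g(1) by (auto simp: K_add_eq_0_iff)
    have "cj om = 1 / (1 + inverse g)" by (simp add: om_def cjg)
    also have "\<dots> = g / (1 + g)" using ne by (simp add: field_simps)
    also have "\<dots> = 1 + 1 / (1 + g)" using ne by (simp add: field_simps)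
    finally show ?thesis by (simp add: om_def)
  qed
  obtain T phi where T: "T \<subseteq> M" "0 \<in> T" "\<And>t t'. t \<in> T \<Longrightarrow> t' \<in> T \<Longrightarrow> t + t' \<in> T"
    "\<And>t. t \<in> T \<Longrightarrow> chi t = 1" "\<And>t. phi t * phi t = (1::real)"
    "\<And>t t'. t \<in> T \<Longrightarrow> t' \<in> T \<Longrightarrow> phi (t + t') = phi t * phi t' * chi (t * t')"
    "\<And>t. t \<in> T \<Longrightarrow> t \<noteq> 0 \<Longrightarrow> \<exists>t'\<in>T. chi (t * t') \<noteq> 1"
    "card T = 2 ^ (a * (n - 1))"
    by (rule exists_quadratic_subspace[OF k a n]) blast
  have "T \<subseteq> L" using T(1) M_subset_L by blast
  then obtain S where S: "bij_betw (\<lambda>(x, t). x + t) (S \<times> T) L"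
    using exists_transversal[OF T(2,3), of L] by auto
  interpret quadratic_transversal k om T S phi
    by unfold_locales (use om T S in auto)
  \<comment> \<open>The index of \<open>T\<close> in \<open>L\<close> is the dimension:
    \<open>2 * a * n - a * (n - 1) = a * (n + 1)\<close>.\<close>
  have "card S * 2 ^ (a * (n - 1)) = d * 2 ^ (a * (n - 1))"
    using card_S n by (auto simp: T(8) k d simp flip: power_add power_mult elim!: oddE)
  then have card: "card S = d" by simp
  then obtain h where h: "bij_betw h {..<d} S"
    using ex_bij_betw_nat_finite[OF finite_S] by (auto simp: lessThan_atLeast0)
  have G: "g \<in> G" using g by (simp add: G_def)
  have pow: "matD d h g ^\<^sub>m m = matD d h (g ^ m)" for m by (rule matD_pow[OF h G])
  show ?thesis
  proof (rule that[of "matD d h g"])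
    show "real_orthogonal_mat d (matD d h g)" by (rule real_orthogonal_mat_matD[OF h G])
    show "matD d h g ^\<^sub>m (2 ^ k + 1) = 1\<^sub>m d" unfolding pow g by (rule matD_1[OF h])
    fix m i j :: nat assume m: "0 < m" "m < 2 ^ k + 1" and ij: "i < d" "j < d"
    have "g ^ m \<noteq> 1" using g(2)[of m] m by auto
    then show "((matD d h g ^\<^sub>m m) $$ (i, j))\<^sup>2 = 1 / d"
      unfolding pow using matD_entry_square[OF h G_closed(4)[OF G] _ ij] by simp
  qed
qed

theorem corollary2:
  fixes q r :: nat
  assumes "\<exists>a\<ge>1. q = 2 ^ a" and "r \<ge> 1"
  shows "\<exists>D :: real mat.
     real_orthogonal_mat (q ^ (2 * r)) D \<and>
     has_mat_order (q ^ (2 * r)) D (q ^ (2 * r - 1) + 1) \<and>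
     defines_mubs (q ^ (2 * r)) {1..q ^ (2 * r - 1) + 1} (\<lambda>k. D ^\<^sub>m k) \<and>
     (\<forall>k\<in>{1..q ^ (2 * r - 1)}.
        real_hadamard_mat (q ^ (2 * r)) (real (q ^ r) \<cdot>\<^sub>m (D ^\<^sub>m k))) \<and>
     inj_on (\<lambda>k. real (q ^ r) \<cdot>\<^sub>m (D ^\<^sub>m k)) {1..q ^ (2 * r - 1)}"
proof -
  obtain a where a: "a \<ge> 1" "q = 2 ^ a" using assms(1) by blast
  \<comment> \<open>The degree of \<open>M\<close> over the field with \<open>q\<close> elements; it
    is odd, and \<open>n + 1 = 2 * r\<close> gives the dimension.\<close>
  define n where "n = 2 * r - 1"
  define d where "d = q ^ (2 * r)"
  define N where "N = q ^ n + 1"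
  have n: "odd n" "n + 1 = 2 * r" using assms(2) by (simp_all add: n_def)
  have q: "q \<ge> 2" using power_increasing[of 1 a "2::nat"] a by simp
  have d2: "2 ^ (a * (n + 1)) = d" unfolding n(2) d_def a(2) power_mult ..
  have N2: "2 ^ (a * n) = q ^ n" unfolding a(2) power_mult ..
  have a0: "a > 0" using a(1) by simp
  obtain D where D: "real_orthogonal_mat d D" "D ^\<^sub>m N = 1\<^sub>m d"
    and entries: "\<And>m i j. 0 < m \<Longrightarrow> m < N \<Longrightarrow> i < d \<Longrightarrow> j < d \<Longrightarrow> ((D ^\<^sub>m m) $$ (i, j))\<^sup>2 = 1 / d"
    using exists_cyclic_orthogonal_mat[OF refl a0 n(1) d2[symmetric]] unfolding N2 N_def by blast
  have d1: "d > 1" using q assms(2) one_less_power[of q "2 * r"] by (simp add: d_def)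
  have qr: "real d = (real (q ^ r))\<^sup>2" "real (q ^ r) > 0"
    using q by (simp_all add: d_def power_mult mult.commute[of 2])
  note mubs = cyclic_mubs[OF D(1) d1 entries]
  \<comment> \<open>Scaling by the nonzero \<open>q ^ r\<close> can be undone, so this reduces to
    distinctness of the powers of \<open>D\<close>.\<close>
  have "inj_on (\<lambda>k. real (q ^ r) \<cdot>\<^sub>m (D ^\<^sub>m k)) {1..q ^ n}"
  proof (rule inj_onI)
    fix i j assume ij: "i \<in> {1..q ^ n}" "j \<in> {1..q ^ n}" "real (q ^ r) \<cdot>\<^sub>m (D ^\<^sub>m i) = real (q ^ r) \<cdot>\<^sub>m (D ^\<^sub>m j)"
    have "(1 / real (q ^ r)) \<cdot>\<^sub>m (real (q ^ r) \<cdot>\<^sub>m A) = A" for A :: "real mat"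
      using qr(2) by (intro eq_matI) auto
    then have "D ^\<^sub>m i = D ^\<^sub>m j" by (metis ij(3))
    then show "i = j" using inj_onD[OF mubs(3)] ij by (auto simp: N_def)
  qed
  moreover have "real_hadamard_mat d (real (q ^ r) \<cdot>\<^sub>m (D ^\<^sub>m m))" if "m \<in> {1..q ^ n}" for m
    using that by (intro real_hadamard_mat_smult real_orthogonal_mat_pow D qr entries) (auto simp: N_def)
  moreover have "has_mat_order d D N"
    using D mubs(1) by (auto simp: has_mat_order_def N_def)
  ultimately show ?thesis
    using D(1) mubs(2) unfolding n_def[symmetric] d_def[symmetric] N_def[symmetric] by blast
qed

end
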